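(* Let $f:\mathbb{R}^d\to\mathbb{R}$ be twice differentiable and $\mu$-strongly convex with $\mu>0$, let $\nabla f$ be Lipschitz continuous with constant $L>0$, and let $\nabla^2 f$ be Lipschitz continuous with constant $M>0$ (i.e. $\|\nabla^2f(x)-\nabla^2f(y)\|\le M\|x-y\|$ for all $x,y$). Let $\kappa=L/\mu$ and let $x_*$ be the minimizer of $f$. Let $\{x_t\}_{t\ge0}$ be the iterates generated by BFGS, where at every iteration the step size satisfies the Armijo-Wolfe conditions with parameters $\alpha,\beta$, and the unit step size $\eta_t=1$ is chosen whenever it satisfies these conditions. Let $x_0\in\mathbb{R}^d$ be an arbitrary initial point. Let $\delta_1,\dots,\delta_8$ be the constants, depending only on $\alpha$ and $\beta$, given in the context. Then for all $t\ge1$: (i) If $B_0=LI$, then $$\frac{f(x_t)-f(x_* )}{f(x_0)-f(x_* )}\le\left(\frac{\delta_7d\kappa+\left(\frac{3\delta_6}{\alpha(1-\beta)}\log\frac{C_0}{\delta_1}+\frac{3\delta_8}{\alpha(1-\beta)}C_0\right)\kappa}{t}\right)^{t}.$$ (ii) If $B_0=\mu I$, then $$\frac{f(x_t)-f(x_* )}{f(x_0)-f(x_* )}\le\left(\frac{(\delta_6+\delta_7+\delta_8C_0)d\log\kappa+\left(\frac{3\delta_6}{\alpha(1-\beta)}\log\frac{C_0}{\delta_1}+\frac{3\delta_8}{\alpha(1-\beta)}C_0\right)\kappa}{t}\right)^{t}.$$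
   Context: BFGS method: given $x_0\in\mathbb{R}^d$ and a symmetric positive definite $B_0\in\mathbb{R}^{d\times d}$, for $t\ge0$ set $g_t=\nabla f(x_t)$, $d_t=-B_t^{-1}g_t$, $x_{t+1}=x_t+\eta_t d_t$ with step size $\eta_t>0$, $s_t=x_{t+1}-x_t$, $y_t=\nabla f(x_{t+1})-\nabla f(x_t)$, and $$B_{t+1}=B_t-\frac{B_ts_ts_t^\top B_t}{s_t^\top B_ts_t}+\frac{y_ty_t^\top}{s_t^\top y_t}.$$ The iterates are assumed non-optimal ($g_t\neq0$), so that all quantities are well defined. Armijo-Wolfe conditions on $\eta_t$, with parameters $0<\alpha<\beta<1$ and $0<\alpha<\frac12$: $$f(x_t+\eta_td_t)\le f(x_t)+\alpha\eta_t\nabla f(x_t)^\top d_t,\qquad \nabla f(x_t+\eta_td_t)^\top d_t\ge\beta\nabla f(x_t)^\top d_t.$$ $C_t:=\frac{M}{\mu^{3/2}}\sqrt{2(f(x_t)-f(x_* ))}$ for $t\ge0$. With $\omega(x)=x-\log(1+x)$ for $x>-1$, the constants are $$\delta_1=\min\left\{\tfrac16,\sqrt{2(1-\alpha)}-1,\tfrac1{\sqrt{1-\beta}}-1\right\},\quad\delta_2=\max\left\{\tfrac78,\tfrac1{\sqrt{2(1-\alpha)}}\right\},\quad\delta_3=\tfrac1{\sqrt{1-\beta}},$$ $$\delta_4=\frac1{\min\{\omega(\delta_2-1),\omega(\delta_3-1)\}},\quad\delta_5=\frac{\max\{2+\frac2{\delta_2},4\delta_3\}}{2\delta_2-1-\delta_1},\quad\delta_6=\log\frac1{2\alpha(1-\beta)},$$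 $$\delta_7=1+\delta_4\delta_6+\delta_5,\quad\delta_8=1+2\delta_7+\frac{2\delta_2-\delta_1-\log\delta_2}{2\delta_2-1-\delta_1}.$$
   Formalization: In both bounds log(C_0/δ_1) is replaced by its positive part max{0, log(C_0/δ_1)}; with the bare logarithm the right-hand side becomes negative at t=1 when C_0 is small, so the stated inequality fails. *)

theory Defs
  imports "HOL-Analysis.Analysis"
begin

definition gradient :: "('a::real_inner \<Rightarrow> real) \<Rightarrow> 'a \<Rightarrow> 'a" where
  "gradient f x = (THE D. GDERIV f x :> D)"

definition hessian :: "(real^'n \<Rightarrow> real) \<Rightarrow> real^'n \<Rightarrow> real^'n^'n" where
  "hessian f x = matrix (frechet_derivative (gradient f) (at x))"

definition twice_differentiable :: "('a::real_inner \<Rightarrow> real) \<Rightarrow> bool" where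
  "twice_differentiable f \<longleftrightarrow>
     (\<forall>x. f differentiable (at x)) \<and> (\<forall>x. gradient f differentiable (at x))"

definition strongly_convex :: "real \<Rightarrow> ('a::real_inner \<Rightarrow> real) \<Rightarrow> bool" where
  "strongly_convex \<mu> f \<longleftrightarrow>
     (\<forall>x y. \<forall>u\<in>{0..1}. f (u *\<^sub>R x + (1 - u) *\<^sub>R y)
        \<le> u * f x + (1 - u) * f y - \<mu> / 2 * u * (1 - u) * (norm (x - y))\<^sup>2)"

(* The norm on matrices as elements of the type real^'n^'n is the Frobenius norm;
   the norm meant here is the spectral norm, hence onorm. *)
definition hessian_lipschitz :: "real \<Rightarrow> (real^'n \<Rightarrow> real) \<Rightarrow> bool" where
  "hessian_lipschitz M f \<longleftrightarrow>
     (\<forall>x y. onorm (\<lambda>v. (hessian f x - hessian f y) *v v) \<le> M * norm (x - y))"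

definition sym_pos_def :: "real^'n^'n \<Rightarrow> bool" where
  "sym_pos_def A \<longleftrightarrow> transpose A = A \<and> (\<forall>v. v \<noteq> 0 \<longrightarrow> v \<bullet> (A *v v) > 0)"

definition outer :: "real^'n \<Rightarrow> real^'n \<Rightarrow> real^'n^'n" where
  "outer u v = (columnvector u :: real^1^'n) ** (rowvector v :: real^'n^1)"

definition bfgs_direction :: "(real^'n \<Rightarrow> real) \<Rightarrow> real^'n \<Rightarrow> real^'n^'n \<Rightarrow> real^'n" where
  "bfgs_direction f x B = - (matrix_inv B *v gradient f x)"

definition bfgs_update :: "real^'n^'n \<Rightarrow> real^'n \<Rightarrow> real^'n \<Rightarrow> real^'n^'n" where
  "bfgs_update B s y =
     B - (1 / (s \<bullet> (B *v s))) *\<^sub>R (B ** outer s s ** B) + (1 / (s \<bullet> y)) *\<^sub>R outer y y"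

(* The requirement that no iterate is optimal belongs to the method: it is what makes the
   denominators in the update nonzero. *)
definition bfgs_iterates ::
  "(real^'n \<Rightarrow> real) \<Rightarrow> (nat \<Rightarrow> real^'n) \<Rightarrow> (nat \<Rightarrow> real^'n^'n) \<Rightarrow> (nat \<Rightarrow> real) \<Rightarrow> bool" where
  "bfgs_iterates f x B \<eta> \<longleftrightarrow>
     sym_pos_def (B 0) \<and>
     (\<forall>t. gradient f (x t) \<noteq> 0 \<and>
          \<eta> t > 0 \<and>
          x (Suc t) = x t + \<eta> t *\<^sub>R bfgs_direction f (x t) (B t) \<and>
          B (Suc t) = bfgs_update (B t) (x (Suc t) - x t)
                        (gradient f (x (Suc t)) - gradient f (x t)))"

definition armijo_wolfe ::
  "('a::real_inner \<Rightarrow> real) \<Rightarrow> real \<Rightarrow> real \<Rightarrow> 'a \<Rightarrow> 'a \<Rightarrow> real \<Rightarrow> bool" where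
  "armijo_wolfe f \<alpha> \<beta> x d \<eta> \<longleftrightarrow>
     f (x + \<eta> *\<^sub>R d) \<le> f x + \<alpha> * \<eta> * (gradient f x \<bullet> d) \<and>
     gradient f (x + \<eta> *\<^sub>R d) \<bullet> d \<ge> \<beta> * (gradient f x \<bullet> d)"

definition C_const :: "real \<Rightarrow> real \<Rightarrow> ('a \<Rightarrow> real) \<Rightarrow> 'a \<Rightarrow> 'a \<Rightarrow> real" where
  "C_const M \<mu> f xs x = M / \<mu> powr (3/2) * sqrt (2 * (f x - f xs))"

definition omega :: "real \<Rightarrow> real" where
  "omega x = x - ln (1 + x)"

definition delta1 :: "real \<Rightarrow> real \<Rightarrow> real" where
  "delta1 \<alpha> \<beta> = Min {1/6, sqrt (2 * (1 - \<alpha>)) - 1, 1 / sqrt (1 - \<beta>) - 1}"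

definition delta2 :: "real \<Rightarrow> real \<Rightarrow> real" where
  "delta2 \<alpha> \<beta> = max (7/8) (1 / sqrt (2 * (1 - \<alpha>)))"

definition delta3 :: "real \<Rightarrow> real \<Rightarrow> real" where
  "delta3 \<alpha> \<beta> = 1 / sqrt (1 - \<beta>)"

definition delta4 :: "real \<Rightarrow> real \<Rightarrow> real" where
  "delta4 \<alpha> \<beta> = 1 / min (omega (delta2 \<alpha> \<beta> - 1)) (omega (delta3 \<alpha> \<beta> - 1))"

definition delta5 :: "real \<Rightarrow> real \<Rightarrow> real" where
  "delta5 \<alpha> \<beta> =
     max (2 + 2 / delta2 \<alpha> \<beta>) (4 * delta3 \<alpha> \<beta>) / (2 * delta2 \<alpha> \<beta> - 1 - delta1 \<alpha> \<beta>)"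

definition delta6 :: "real \<Rightarrow> real \<Rightarrow> real" where
  "delta6 \<alpha> \<beta> = ln (1 / (2 * \<alpha> * (1 - \<beta>)))"

definition delta7 :: "real \<Rightarrow> real \<Rightarrow> real" where
  "delta7 \<alpha> \<beta> = 1 + delta4 \<alpha> \<beta> * delta6 \<alpha> \<beta> + delta5 \<alpha> \<beta>"

definition delta8 :: "real \<Rightarrow> real \<Rightarrow> real" where
  "delta8 \<alpha> \<beta> =
     1 + 2 * delta7 \<alpha> \<beta>
       + (2 * delta2 \<alpha> \<beta> - delta1 \<alpha> \<beta> - ln (delta2 \<alpha> \<beta>))
           / (2 * delta2 \<alpha> \<beta> - 1 - delta1 \<alpha> \<beta>)"

(* In the rates, ln (C / delta1) measures the length of an initial phase that lasts until
   C_t <= delta1. That length is zero, not negative, if C_0 <= delta1 already, so the positive part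
   is taken. With the bare logarithm the bases of the rates would be negative for small C_0, and the
   bounds false at t = 1. *)
definition log_plus :: "real \<Rightarrow> real" where
  "log_plus r = max 0 (ln r)"

end

theory Submission
  imports Defs
begin

text \<open>
Write \<open>F\<^sub>t = f (x\<^sub>t) - f xs\<close>, let \<open>s\<close> and \<open>y\<close> be the step and the gradient difference of iteration
\<open>t\<close>, and let \<open>P\<close> be a symmetric positive definite weight. The fraction of the optimality gap that the
iteration removes factors as

  \<open>(F\<^sub>t - F\<^sub>t\<^sub>+\<^sub>1) / F\<^sub>t = (F\<^sub>t - F\<^sub>t\<^sub>+\<^sub>1) / \<gamma> \<sqdot> (s \<bullet> y) / \<gamma> \<sqdot> G / F\<^sub>t \<sqdot> \<gamma>\<^sup>2 / (G (s \<bullet> y))\<close>,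
  where \<open>\<gamma> = - (g \<bullet> s)\<close> and \<open>G = g \<bullet> P\<^sup>-\<^sup>1 g\<close>.

The line search bounds the first two factors below by \<open>\<alpha>\<close> and \<open>1 - \<beta>\<close>, and strong convexity relative
to \<open>P\<close> bounds the third. The last factor measures the angle between the step and the gradient and may
be tiny in a single iteration, but not in many: its negative logarithm is at most the decrease of
the potential \<open>\<Psi>(B) = tr (P\<^sup>-\<^sup>1 B) - d - ln det (P\<^sup>-\<^sup>1 B)\<close> plus \<open>(y \<bullet> P\<^sup>-\<^sup>1 y) / (s \<bullet> y) - 1\<close>
(\<open>potential_decrease_angle\<close>). Since \<open>\<Psi> \<ge> 0\<close> (\<open>potential_nonneg\<close>), the decreases sum to at most
\<open>\<Psi>(B\<^sub>0)\<close>.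

The argument is run with two weights. For \<open>P = L I\<close> the correction \<open>(y \<bullet> P\<^sup>-\<^sup>1 y) / (s \<bullet> y) - 1\<close> is never
positive, which yields a linear rate (\<open>gap_ratio_linear\<close>). Hence \<open>C\<^sub>t\<close>, which is proportional to the
square root of \<open>F\<^sub>t\<close>, decays geometrically after about \<open>\<Psi>(B\<^sub>0)\<close> iterations. This bounds both the sum
of all \<open>C\<^sub>t\<close> and the number of iterations with \<open>C\<^sub>t > \<delta>\<^sub>1\<close>.

For \<open>P = \<nabla>\<^sup>2f(xs)\<close> all comparisons between \<open>f\<close> and its quadratic model at \<open>xs\<close> hold up to a factor
\<open>1 + C\<^sub>t\<close>. Let \<open>\<rho> = (s \<bullet> B s) / (s \<bullet> P s)\<close>. The quantity \<open>\<omega>(\<rho> - 1)\<close> is bounded by the decrease of \<open>\<Psi>\<close>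
up to \<open>2 C\<^sub>t\<close> as well. If \<open>C\<^sub>t \<le> \<delta>\<^sub>1\<close> and \<open>\<delta>\<^sub>2 \<le> \<rho> \<le> \<delta>\<^sub>3\<close>, the unit step satisfies the line search
conditions, and the product of the first three factors differs from 1 by terms of order
\<open>(\<rho> - 1)\<^sup>2\<close> and \<open>C\<^sub>t\<close>; if \<open>\<rho>\<close> lies outside this interval, then \<open>\<omega>(\<rho> - 1) \<ge> 1 / \<delta>\<^sub>4\<close> pays for the constant
loss \<open>\<delta>\<^sub>6\<close>. Altogether the loss \<open>- ln (1 - F\<^sub>t\<^sub>+\<^sub>1 / F\<^sub>t)\<close> of every iteration is at most
\<open>\<delta>\<^sub>7\<close> times the decrease of \<open>\<Psi>\<close>, plus \<open>\<delta>\<^sub>8 C\<^sub>t\<close>, plus \<open>\<delta>\<^sub>6\<close> if \<open>C\<^sub>t > \<delta>\<^sub>1\<close> (\<open>loss_le_superlinear\<close>). So the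
losses have a sum \<open>R\<close> that is bounded independently of the number of iterations. As \<open>F\<^sub>t\<^sub>+\<^sub>1 / F\<^sub>t\<close> is at
most the loss, the inequality of arithmetic and geometric means gives \<open>F\<^sub>t / F\<^sub>0 \<le> (R / t)\<^sup>t\<close>.
\<close>

section \<open>Symmetric positive definite matrices\<close>

lemma outer_mult_vec: "outer u v *v w = (v \<bullet> w) *\<^sub>R u"
  by (simp add: outer_def vec_eq_iff matrix_matrix_mult_def matrix_vector_mult_def rowvector_def
      columnvector_def inner_vec_def sum_distrib_left sum_distrib_right mult_ac)

lemma transpose_outer: "transpose (outer u v) = outer v u"
  by (simp add: outer_def vec_eq_iff transpose_def matrix_matrix_mult_def rowvector_def columnvector_def mult_ac)

lemma symmetric_inner_swap:
  fixes A :: "real^'n^'n"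
  assumes "transpose A = A"
  shows "u \<bullet> (A *v w) = (A *v u) \<bullet> w"
  by (metis assms dot_lmul_matrix transpose_matrix_vector)

lemma matrix_eq_if_all_vec:
  fixes A :: "real^'n^'n"
  assumes "\<And>v. A *v v = B *v v" shows "A = B"
  using assms matrix_eq by blast

lemma transpose_eq_if_inner_swap:
  fixes A :: "real^'n^'n"
  assumes "\<And>u w. u \<bullet> (A *v w) = (A *v u) \<bullet> w"
  shows "transpose A = A"
proof (rule matrix_eq_if_all_vec)
  fix v
  have "u \<bullet> (transpose A *v v) = u \<bullet> (A *v v)" for u
    using assms[of u v] by (metis dot_lmul_matrix inner_commute transpose_matrix_vector)
  thus "transpose A *v v = A *v v" using vector_eq_rdot by (metis inner_commute)
qed

lemma spd_inner_swap: "sym_pos_def A \<Longrightarrow> u \<bullet> (A *v w) = (A *v u) \<bullet> w"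
  unfolding sym_pos_def_def by (simp add: symmetric_inner_swap)

lemma spd_pos: "sym_pos_def A \<Longrightarrow> v \<noteq> 0 \<Longrightarrow> v \<bullet> (A *v v) > 0"
  unfolding sym_pos_def_def by simp

lemma spd_nonneg: "sym_pos_def A \<Longrightarrow> v \<bullet> (A *v v) \<ge> 0"
  using spd_pos[of A v] by (cases "v = 0") auto

lemma spd_invertible:
  assumes "sym_pos_def A" shows "invertible A"
proof -
  have "v = 0" if "A *v v = 0" for v
    using spd_pos[OF assms, of v] that by fastforce
  thus ?thesis
    by (metis invertible_left_inverse matrix_left_invertible_ker)
qed

lemma invertible_inverse:
  fixes A :: "real^'n^'n"
  assumes "invertible A"
  shows "A ** matrix_inv A = mat 1" and "matrix_inv A ** A = mat 1"
  using someI_ex[OF assms[unfolded invertible_def]] by (simp_all add: matrix_inv_def)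

lemma spd_inv_cancel:
  assumes "sym_pos_def A"
  shows "A *v (matrix_inv A *v v) = v" and "matrix_inv A *v (A *v v) = v"
  using spd_invertible[OF assms]
  by (simp_all add: matrix_vector_mul_assoc invertible_inverse)

lemma spd_inverse:
  assumes "sym_pos_def A" shows "sym_pos_def (matrix_inv A)"
  unfolding sym_pos_def_def
proof (intro conjI allI impI)
  let ?I = "matrix_inv A"
  have "u \<bullet> (?I *v w) = (?I *v u) \<bullet> w" for u w
    by (metis spd_inv_cancel(1)[OF assms] spd_inner_swap[OF assms])
  thus "transpose ?I = ?I" by (rule transpose_eq_if_inner_swap)
next
  fix v :: "real^'a" assume "v \<noteq> 0"
  hence "matrix_inv A *v v \<noteq> 0" using spd_inv_cancel(1)[OF assms, of v] by auto
  thus "0 < v \<bullet> (matrix_inv A *v v)"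
    by (metis spd_inv_cancel(1)[OF assms] inner_commute spd_pos[OF assms])
qed

text \<open>
Expanding the form at \<open>c u - v\<close>. This additive version of Cauchy-Schwarz is linear in the values of
the form, so that it can be applied pointwise to a derivative and then integrated.
\<close>

lemma nonneg_form_Cauchy_Schwarz:
  fixes A :: "real^'n^'n"
  assumes sym: "transpose A = A" and psd: "\<And>v. v \<bullet> (A *v v) \<ge> 0" and c: "c > 0"
  shows "2 * (u \<bullet> (A *v v)) \<le> c * (u \<bullet> (A *v u)) + (v \<bullet> (A *v v)) / c"
proof -
  have "0 \<le> (c *\<^sub>R u - v) \<bullet> (A *v (c *\<^sub>R u - v))" by (rule psd)
  also have "\<dots> = c * (c * (u \<bullet> (A *v u)) - 2 * (u \<bullet> (A *v v))) + v \<bullet> (A *v v)"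
    using symmetric_inner_swap[OF sym, of v u]
    by (simp add: matrix_vector_mult_diff_distrib matrix_vector_mult_scaleR inner_diff_left inner_diff_right
        inner_commute algebra_simps)
  finally have "0 \<le> (c * (c * (u \<bullet> (A *v u)) - 2 * (u \<bullet> (A *v v))) + v \<bullet> (A *v v)) / c"
    using c by simp
  thus ?thesis using c by (simp add: field_simps)
qed

text \<open>
The forms of \<open>P\<close> and \<open>P\<^sup>-\<^sup>1\<close> are the squares of dual norms: up to the factor \<open>G = w \<bullet> P\<^sup>-\<^sup>1 w\<close> the
inequality says that the form of \<open>P\<close> is nonnegative at \<open>(w \<bullet> v) P\<^sup>-\<^sup>1 w - G v\<close>.
\<close>

lemma dual_norms_Cauchy_Schwarz:
  assumes P: "sym_pos_def P"
  shows "(w \<bullet> v)\<^sup>2 \<le> (w \<bullet> (matrix_inv P *v w)) * (v \<bullet> (P *v v))"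
proof (cases "w = 0")
  case False
  let ?u = "matrix_inv P *v w" and ?G = "w \<bullet> (matrix_inv P *v w)"
  have G: "?G > 0" using spd_pos[OF spd_inverse[OF P] False] .
  have uu: "?u \<bullet> (P *v ?u) = ?G" by (simp add: spd_inv_cancel[OF P] inner_commute)
  have vu: "v \<bullet> (P *v ?u) = w \<bullet> v" by (simp add: spd_inv_cancel[OF P] inner_commute)
  have uv: "?u \<bullet> (P *v v) = w \<bullet> v" using spd_inner_swap[OF P, of ?u v] by (simp add: spd_inv_cancel[OF P])
  have "0 \<le> ((w \<bullet> v) *\<^sub>R ?u - ?G *\<^sub>R v) \<bullet> (P *v ((w \<bullet> v) *\<^sub>R ?u - ?G *\<^sub>R v))"
    by (rule spd_nonneg[OF P])
  also have "\<dots> = ?G * (?G * (v \<bullet> (P *v v)) - (w \<bullet> v)\<^sup>2)"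
    by (simp add: matrix_vector_mult_diff_distrib matrix_vector_mult_scaleR inner_diff_left inner_diff_right
        uu vu uv algebra_simps power2_eq_square)
  finally show ?thesis using G by (simp add: zero_le_mult_iff)
qed simp

text \<open>
The matrix \<open>I + s z\<^sup>T\<close> arises from the identity by adding a multiple of \<open>z\<close> to each row. By linearity in
the rows these changes can be made one after the other; a term in which \<open>z\<close> occurs in two rows
vanishes, so only the terms with a single row replaced by \<open>z\<close> remain.
\<close>

lemma det_identity_plus_outer:
  fixes s z :: "real^'n"
  shows "det (mat 1 + outer s z) = 1 + s \<bullet> z"
proof -
  define R :: "'n set \<Rightarrow> 'n \<Rightarrow> real^'n"
    where "R K i = (if i \<in> K then axis i 1 + s$i *s z else axis i 1)" for K i
  have X: "det (\<chi> i. if i = k then z else R K i) = z$k" if "finite K" "k \<notin> K" for K k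
    using that
  proof (induction K rule: finite_induct)
    case empty
    have z: "(\<Sum>i\<in>UNIV. z$i *s row i (mat 1 :: real^'n^'n)) = z"
      by (simp add: vec_eq_iff row_def mat_def if_distrib cong: if_cong)
    have "R {} = (\<lambda>i. row i (mat 1 :: real^'n^'n))"
      by (auto simp: R_def fun_eq_iff vec_eq_iff row_def mat_def axis_def)
    thus ?case using cramer_lemma_transpose[of k z "mat 1"] by (simp only: z det_I mult_1_right)
  next
    case (insert m K)
    have mk: "m \<noteq> k" using insert by auto
    define c where "c i = (if i = k then z else R K i)" for i
    have "(\<chi> i. if i = k then z else R (insert m K) i) = (\<chi> i. if i = m then axis m 1 + s$m *s z else c i)"
      using mk by (auto simp: R_def c_def vec_eq_iff)
    moreover have "det (\<chi> i. if i = m then axis m 1 + s$m *s z else c i)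
        = det (\<chi> i. if i = m then axis m 1 else c i) + s$m * det (\<chi> i. if i = m then z else c i)"
      by (simp only: det_row_add det_row_mul)
    moreover have "(\<chi> i. if i = m then axis m 1 else c i) = (\<chi> i. if i = k then z else R K i)"
      using mk insert(2) by (auto simp: R_def c_def vec_eq_iff)
    moreover have "det (\<chi> i. if i = m then z else c i) = 0"
      by (rule det_identical_rows[OF mk]) (use mk in \<open>simp add: row_def c_def vec_eq_iff\<close>)
    ultimately show ?case using insert by simp
  qed
  have "det (\<chi> i. R K i) = 1 + (\<Sum>i\<in>K. s$i * z$i)" if "finite K" for K
    using that
  proof (induction K rule: finite_induct)
    case empty
    have "(\<chi> i. R {} i) = mat 1" by (simp add: R_def vec_eq_iff mat_def axis_def)
    thus ?case by simp
  next
    case (insert k K)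
    have "(\<chi> i. R (insert k K) i) = (\<chi> i. if i = k then axis k 1 + s$k *s z else R K i)"
      using insert(2) by (auto simp: R_def vec_eq_iff)
    moreover have "det (\<chi> i. if i = k then axis k 1 + s$k *s z else R K i)
        = det (\<chi> i. if i = k then axis k 1 else R K i) + s$k * det (\<chi> i. if i = k then z else R K i)"
      by (simp only: det_row_add det_row_mul)
    moreover have "(\<chi> i. if i = k then axis k 1 else R K i) = (\<chi> i. R K i)"
      using insert(2) by (auto simp: R_def vec_eq_iff)
    ultimately show ?case using insert X[of K k] by simp
  qed
  from this[of UNIV] have "det (\<chi> i. R UNIV i) = 1 + (\<Sum>i\<in>UNIV. s$i * z$i)" by simp
  moreover have "(\<chi> i. R UNIV i) = mat 1 + outer s z"
    by (auto simp: R_def vec_eq_iff mat_def axis_def outer_def matrix_matrix_mult_def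
        rowvector_def columnvector_def)
  ultimately show ?thesis by (simp add: inner_vec_def)
qed

section \<open>The BFGS update as a congruence\<close>

lemma bfgs_update_mult_vec:
  assumes "transpose B = B"
  shows "bfgs_update B s y *v v
    = B *v v - (((B *v s) \<bullet> v) / (s \<bullet> (B *v s))) *\<^sub>R (B *v s) + ((y \<bullet> v) / (s \<bullet> y)) *\<^sub>R y"
  using symmetric_inner_swap[OF assms, of s v]
  by (simp add: bfgs_update_def matrix_vector_mult_add_rdistrib matrix_vector_mult_diff_rdistrib
      scaleR_matrix_vector_assoc[symmetric] matrix_vector_mul_assoc[symmetric] outer_mult_vec
      matrix_vector_mult_scaleR)

text \<open>
For any \<open>z\<close>, completing the square in \<open>(I + z s\<^sup>T) B (I + s z\<^sup>T)\<close> gives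
\<open>B - B s s\<^sup>T B / b + b (z + B s / b) (z + B s / b)\<^sup>T\<close>. The choice of \<open>z\<close> makes the last term equal to
\<open>y y\<^sup>T / (s \<bullet> y)\<close>. Definiteness and determinant of the update can be read off from this congruence.
\<close>

lemma bfgs_update_product_form:
  assumes B: "sym_pos_def B" and s: "s \<noteq> 0" and sy: "s \<bullet> y > 0"
  defines "b \<equiv> s \<bullet> (B *v s)"
  defines "E \<equiv> mat 1 + outer s ((1 / sqrt (s \<bullet> y * b)) *\<^sub>R y - (1 / b) *\<^sub>R (B *v s))"
  shows "bfgs_update B s y = transpose E ** B ** E" and "det E = sqrt (s \<bullet> y / b)"
proof -
  have b: "b > 0" using spd_pos[OF B s] by (simp add: b_def)
  have sB: "transpose B = B" using B by (simp add: sym_pos_def_def)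
  define z where "z = (1 / sqrt (s \<bullet> y * b)) *\<^sub>R y - (1 / b) *\<^sub>R (B *v s)"
  have E: "E = mat 1 + outer s z" by (simp add: E_def z_def)
  have Ev: "E *v v = v + (z \<bullet> v) *\<^sub>R s" for v
    by (simp add: E matrix_vector_mult_add_rdistrib outer_mult_vec)
  have tE: "transpose E = mat 1 + outer z s"
  proof -
    have "transpose (mat 1 + outer s z) = transpose (mat 1) + transpose (outer s z)"
      by (simp add: transpose_def vec_eq_iff)
    thus ?thesis by (simp add: E transpose_outer transpose_mat)
  qed
  have tEv: "transpose E *v v = v + (s \<bullet> v) *\<^sub>R z" for v
    by (simp add: tE matrix_vector_mult_add_rdistrib outer_mult_vec)
  show "bfgs_update B s y = transpose E ** B ** E"
  proof (rule matrix_eq_if_all_vec)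
    fix v
    let ?w = "B *v s"
    have sw: "s \<bullet> ?w = b" by (simp add: b_def)
    \<comment> \<open>This is the property for which \<open>z\<close> is chosen.\<close>
    have zs: "?w + b *\<^sub>R z = (b / sqrt (s \<bullet> y * b)) *\<^sub>R y"
      using b by (simp add: z_def scaleR_diff_right)
    have c: "b / sqrt (s \<bullet> y * b) * (1 / sqrt (s \<bullet> y * b)) = 1 / (s \<bullet> y)"
      using b sy by (simp add: field_simps)
    have "(transpose E ** B ** E) *v v = transpose E *v (B *v (E *v v))"
      by (simp add: matrix_vector_mul_assoc matrix_mul_assoc)
    also have "\<dots> = B *v v + (z \<bullet> v) *\<^sub>R (?w + b *\<^sub>R z) + (?w \<bullet> v) *\<^sub>R z"
      by (simp add: Ev tEv matrix_vector_right_distrib matrix_vector_mult_scaleR inner_add_right sw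
          symmetric_inner_swap[OF sB, of s v] algebra_simps del: transpose_matrix_vector)
    also have "\<dots> = B *v v + (z \<bullet> v + (?w \<bullet> v) / b) *\<^sub>R (?w + b *\<^sub>R z) - ((?w \<bullet> v) / b) *\<^sub>R ?w"
      using b by (simp add: algebra_simps)
    also have "z \<bullet> v + (?w \<bullet> v) / b = (1 / sqrt (s \<bullet> y * b)) * (y \<bullet> v)"
      by (simp add: z_def inner_diff_left)
    also have "\<dots> *\<^sub>R (?w + b *\<^sub>R z) = (b / sqrt (s \<bullet> y * b) * (1 / sqrt (s \<bullet> y * b)) * (y \<bullet> v)) *\<^sub>R y"
      by (simp add: zs mult_ac)
    also have "\<dots> = ((y \<bullet> v) / (s \<bullet> y)) *\<^sub>R y" by (simp only: c) simp
    finally show "bfgs_update B s y *v v = (transpose E ** B ** E) *v v"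
      by (simp add: bfgs_update_mult_vec[OF sB] b_def)
  qed
  have "det E = 1 + s \<bullet> z" by (simp add: E det_identity_plus_outer)
  also have "\<dots> = s \<bullet> y / sqrt (s \<bullet> y * b)" using b by (simp add: z_def inner_diff_right flip: b_def)
  also have "\<dots> = sqrt (s \<bullet> y / b)"
    using b sy by (simp add: real_sqrt_mult real_sqrt_divide field_simps)
  finally show "det E = sqrt (s \<bullet> y / b)" .
qed

lemma det_bfgs_update:
  assumes B: "sym_pos_def B" and s: "s \<noteq> 0" and sy: "s \<bullet> y > 0"
  shows "det (bfgs_update B s y) = det B * (s \<bullet> y / (s \<bullet> (B *v s)))"
proof -
  define r where "r = s \<bullet> y / (s \<bullet> (B *v s))"
  have r: "r > 0" using spd_pos[OF B s] sy by (simp add: r_def)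
  have "det (bfgs_update B s y) = sqrt r * det B * sqrt r"
    unfolding bfgs_update_product_form(1)[OF assms] det_mul det_transpose
      bfgs_update_product_form(2)[OF assms] r_def ..
  also have "\<dots> = det B * r" using r by (simp add: mult_ac)
  finally show ?thesis by (simp add: r_def)
qed

lemma spd_bfgs_update:
  assumes B: "sym_pos_def B" and s: "s \<noteq> 0" and sy: "s \<bullet> y > 0"
  shows "sym_pos_def (bfgs_update B s y)"
proof -
  define b where "b = s \<bullet> (B *v s)"
  define E where "E = mat 1 + outer s ((1 / sqrt (s \<bullet> y * b)) *\<^sub>R y - (1 / b) *\<^sub>R (B *v s))"
  have upd: "bfgs_update B s y = transpose E ** B ** E" and dE: "det E = sqrt (s \<bullet> y / b)"
    using bfgs_update_product_form[OF assms] by (simp_all add: b_def E_def)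
  have "b > 0" using spd_pos[OF B s] by (simp add: b_def)
  hence "invertible E" using dE sy by (simp add: invertible_det_nz)
  hence E0: "E *v v \<noteq> 0" if "v \<noteq> 0" for v
    using that by (metis invertible_left_inverse matrix_left_invertible_ker)
  have eq: "bfgs_update B s y *v w = transpose E *v (B *v (E *v w))" for w
    by (simp add: upd matrix_vector_mul_assoc matrix_mul_assoc)
  have form: "u \<bullet> (bfgs_update B s y *v w) = (E *v u) \<bullet> (B *v (E *v w))" for u w
    by (metis eq dot_lmul_matrix transpose_matrix_vector transpose_transpose)
  have "transpose (bfgs_update B s y) = bfgs_update B s y"
    by (rule transpose_eq_if_inner_swap) (metis form inner_commute spd_inner_swap[OF B])
  thus ?thesis using spd_pos[OF B] E0 by (simp add: sym_pos_def_def form)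
qed

text \<open>
Finite termination of BFGS on a quadratic with Hessian \<open>P\<close>. Let \<open>V\<close> be the space of all \<open>v\<close> with
\<open>B v = P v\<close>. If \<open>V\<close> is not the whole space, there is \<open>s \<noteq> 0\<close> orthogonal to \<open>P V\<close>; the update along \<open>s\<close>
with \<open>y = P s\<close> leaves \<open>B\<close> unchanged on \<open>V\<close> and adds \<open>s\<close> to \<open>V\<close>. So a chain of updates leads from \<open>B\<close> to
\<open>P\<close>, and a property that passes backwards along updates passes from \<open>P\<close> to \<open>B\<close>. It replaces
arguments with eigenvalues below.
\<close>

lemma spd_bfgs_induct:
  fixes B P :: "real^'n^'n"
  assumes P: "sym_pos_def P" and B: "sym_pos_def B"
    and base: "Q P"
    and step: "\<And>B s. sym_pos_def B \<Longrightarrow> s \<noteq> 0 \<Longrightarrow> Q (bfgs_update B s (P *v s)) \<Longrightarrow> Q B"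
  shows "Q B"
  using B
proof (induction "CARD('n) - dim {v. B *v v = P *v v}" arbitrary: B rule: less_induct)
  case less
  let ?V = "\<lambda>B. {v. B *v v = P *v v}"
  have subspace: "subspace (?V A)" for A
    by (auto simp: subspace_def matrix_vector_right_distrib matrix_vector_mult_scaleR)
  show ?case
  proof (cases "?V B = UNIV")
    case True
    hence "B = P" by (intro matrix_eq_if_all_vec) auto
    thus ?thesis using base by simp
  next
    case False
    have linP: "linear ((*v) P)" by simp
    have subW: "subspace ((*v) P ` ?V B)" using subspace by (rule linear_subspace_image[OF linP])
    have "(*v) P ` ?V B \<noteq> UNIV"
    proof
      assume UN: "(*v) P ` ?V B = UNIV"
      have "v \<in> ?V B" for v
      proof -
        have "P *v v \<in> (*v) P ` ?V B" by (simp add: UN)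
        then obtain w where "w \<in> ?V B" "P *v v = P *v w" by auto
        moreover hence "v = w" by (metis spd_inv_cancel(2)[OF P])
        ultimately show ?thesis by simp
      qed
      thus False using False by auto
    qed
    hence "dim ((*v) P ` ?V B) \<noteq> DIM(real^'n)"
      unfolding dim_eq_full using subW by (simp add: span_eq_iff[THEN iffD2])
    hence "dim ((*v) P ` ?V B) < DIM(real^'n)" using dim_subset_UNIV le_neq_implies_less by blast
    then obtain s where s: "s \<noteq> 0" "\<And>w. w \<in> span ((*v) P ` ?V B) \<Longrightarrow> orthogonal s w"
      using orthogonal_to_subspace_exists by blast
    let ?B' = "bfgs_update B s (P *v s)"
    have Ps: "s \<bullet> (P *v s) > 0" using spd_pos[OF P s(1)] .
    have B': "sym_pos_def ?B'" by (rule spd_bfgs_update[OF less.prems s(1) Ps])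
    have sB: "transpose B = B" using less.prems by (simp add: sym_pos_def_def)
    have upd: "?B' *v v = B *v v - (((B *v s) \<bullet> v) / (s \<bullet> (B *v s))) *\<^sub>R (B *v s)
        + (((P *v s) \<bullet> v) / (s \<bullet> (P *v s))) *\<^sub>R (P *v s)" for v
      by (rule bfgs_update_mult_vec[OF sB])
    have "v \<in> ?V ?B'" if "v \<in> ?V B" for v
    proof -
      have "s \<bullet> (P *v v) = 0" using s(2)[of "P *v v"] that by (auto simp: orthogonal_def intro: span_base)
      hence "(P *v s) \<bullet> v = 0" "(B *v s) \<bullet> v = 0"
        using that spd_inner_swap[OF P, of s v] spd_inner_swap[OF less.prems, of s v] by simp_all
      thus ?thesis using that by (simp add: upd)
    qed
    moreover have "s \<in> ?V ?B'"
      using Ps spd_pos[OF less.prems s(1)] by (simp add: upd inner_commute)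
    moreover have "s \<notin> ?V B"
      using s(2)[of "P *v s"] Ps by (auto simp: orthogonal_def intro: span_base)
    ultimately have "?V B \<subset> ?V ?B'" by blast
    hence "dim (?V B) < dim (?V ?B')"
      using dim_psubset[of "?V B" "?V ?B'"] by (simp only: span_eq_iff[THEN iffD2, OF subspace])
    moreover have "dim (?V ?B') \<le> CARD('n)" using dim_subset_UNIV[of "?V ?B'"] by simp
    ultimately have "CARD('n) - dim (?V ?B') < CARD('n) - dim (?V B)" by linarith
    hence "Q ?B'" using less.hyps B' by blast
    thus ?thesis using step[OF less.prems s(1)] by blast
  qed
qed

lemma spd_mat_1: "sym_pos_def (mat 1 :: real^'n^'n)"
  by (simp add: sym_pos_def_def)

text \<open>
An update multiplies the determinant by a positive factor, so its sign is constant along the chain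
from \<open>B\<close> to the identity.
\<close>

lemma spd_det_pos:
  fixes B :: "real^'n^'n"
  assumes "sym_pos_def B" shows "det B > 0"
proof (rule spd_bfgs_induct[OF spd_mat_1 assms, where Q = "\<lambda>B. det B > 0"])
  fix B :: "real^'n^'n" and s :: "real^'n"
  assume B: "sym_pos_def B" "s \<noteq> 0" and d: "det (bfgs_update B s (mat 1 *v s)) > 0"
  have "s \<bullet> s > 0" using B by simp
  hence "(s \<bullet> s) / (s \<bullet> (B *v s)) > 0" using spd_pos[OF B] by simp
  moreover have "det B * ((s \<bullet> s) / (s \<bullet> (B *v s))) > 0"
    using d det_bfgs_update[OF B, of s] \<open>s \<bullet> s > 0\<close> by simp
  ultimately show "det B > 0" by (simp only: zero_less_mult_pos2)
qed simp

section \<open>The potential of a BFGS matrix\<close>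

text \<open>
The log-determinant divergence of \<open>B\<close> from \<open>P\<close>: twice the Kullback-Leibler divergence of the centred
normal distribution with covariance \<open>B\<close> from the one with covariance \<open>P\<close>.
\<close>

definition bfgs_potential :: "real^'n^'n \<Rightarrow> real^'n^'n \<Rightarrow> real" where
  "bfgs_potential P B = trace (matrix_inv P ** B) - real CARD('n) - ln (det B / det P)"

lemma trace_mult_outer: "trace (Q ** outer u v) = v \<bullet> (Q *v u)"
  by (simp add: trace_def outer_def matrix_matrix_mult_def matrix_vector_mult_def rowvector_def columnvector_def
      inner_vec_def sum_distrib_left mult_ac)

lemma trace_scaleR: "trace (c *\<^sub>R A) = c * trace (A :: real^'n^'n)"
  by (simp add: trace_def sum_distrib_left)

lemma potential_bfgs_update:
  fixes P B :: "real^'n^'n"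
  assumes P: "sym_pos_def P" and B: "sym_pos_def B" and s: "s \<noteq> 0" and sy: "s \<bullet> y > 0"
  defines "b \<equiv> s \<bullet> (B *v s)"
  shows "bfgs_potential P (bfgs_update B s y) = bfgs_potential P B
    + (y \<bullet> (matrix_inv P *v y)) / (s \<bullet> y) - ((B *v s) \<bullet> (matrix_inv P *v (B *v s))) / b - ln (s \<bullet> y / b)"
proof -
  have sB: "transpose B = B" using B by (simp add: sym_pos_def_def)
  have b: "b > 0" using spd_pos[OF B s] by (simp add: b_def)
  have "B ** outer s s ** B = outer (B *v s) (B *v s)"
    by (rule matrix_eq_if_all_vec)
       (simp add: matrix_vector_mul_assoc[symmetric] outer_mult_vec matrix_vector_mult_scaleR symmetric_inner_swap[OF sB])
  hence "matrix_inv P ** bfgs_update B s y = matrix_inv P ** B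
      - (1 / b) *\<^sub>R (matrix_inv P ** outer (B *v s) (B *v s)) + (1 / (s \<bullet> y)) *\<^sub>R (matrix_inv P ** outer y y)"
    by (simp add: bfgs_update_def b_def matrix_eq matrix_vector_mul_assoc[symmetric]
        matrix_vector_mult_add_rdistrib matrix_vector_mult_diff_rdistrib matrix_vector_right_distrib
        matrix_vector_mult_diff_distrib scaleR_matrix_vector_assoc[symmetric] matrix_vector_mult_scaleR)
  hence tr: "trace (matrix_inv P ** bfgs_update B s y) = trace (matrix_inv P ** B)
      - ((B *v s) \<bullet> (matrix_inv P *v (B *v s))) / b + (y \<bullet> (matrix_inv P *v y)) / (s \<bullet> y)"
    by (simp add: trace_add trace_sub trace_scaleR trace_mult_outer)
  have "det (bfgs_update B s y) / det P = det B / det P * (s \<bullet> y / b)"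
    by (simp add: det_bfgs_update[OF B s sy] b_def)
  hence "ln (det (bfgs_update B s y) / det P) = ln (det B / det P) + ln (s \<bullet> y / b)"
    using spd_det_pos[OF P] spd_det_pos[OF B] sy b by (simp only: ln_mult_pos divide_pos_pos)
  thus ?thesis by (simp add: bfgs_potential_def tr)
qed

lemma ln_le_self_minus_one: "x > 0 \<Longrightarrow> ln x + 1 \<le> (x::real)"
  using ln_le_minus_one[of x] by simp

text \<open>
With \<open>a = (B s \<bullet> P\<^sup>-\<^sup>1 B s) / (s \<bullet> B s)\<close>, the update changes the potential by exactly the logarithm on the
left, the correction on the right, and \<open>- (a - 1 - ln a)\<close>, which is not positive.
\<close>

lemma potential_decrease_angle:
  fixes P B :: "real^'n^'n"
  assumes P: "sym_pos_def P" and B: "sym_pos_def B" and s: "s \<noteq> 0" and sy: "s \<bullet> y > 0"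
  shows "- ln ((s \<bullet> (B *v s))\<^sup>2 / (((B *v s) \<bullet> (matrix_inv P *v (B *v s))) * (s \<bullet> y)))
    \<le> bfgs_potential P B - bfgs_potential P (bfgs_update B s y) + (y \<bullet> (matrix_inv P *v y)) / (s \<bullet> y) - 1"
proof -
  define b e where "b = s \<bullet> (B *v s)" and "e = (B *v s) \<bullet> (matrix_inv P *v (B *v s))"
  have b: "b > 0" using spd_pos[OF B s] by (simp add: b_def)
  have "B *v s \<noteq> 0" using b by (auto simp: b_def)
  hence e: "e > 0" using spd_pos[OF spd_inverse[OF P]] by (simp add: e_def)
  have "ln (e / b) + 1 \<le> e / b" using ln_le_self_minus_one[of "e / b"] e b by simp
  moreover have "- ln (b\<^sup>2 / (e * (s \<bullet> y))) = ln (e / b) + ln (s \<bullet> y / b)"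
    using b e sy by (simp add: ln_div ln_mult_pos ln_realpow)
  ultimately show ?thesis
    unfolding potential_bfgs_update[OF assms] by (simp flip: b_def e_def)
qed

text \<open>
The duality of the norms gives \<open>(B s \<bullet> P\<^sup>-\<^sup>1 B s) / (s \<bullet> B s) \<ge> (s \<bullet> B s) / (s \<bullet> P s)\<close>. So a curvature
of \<open>B\<close> along \<open>s\<close> that is far from the one of \<open>P\<close> forces the potential to decrease.
\<close>

lemma potential_decrease_omega:
  fixes P B :: "real^'n^'n"
  assumes P: "sym_pos_def P" and B: "sym_pos_def B" and s: "s \<noteq> 0" and sy: "s \<bullet> y > 0"
  shows "omega ((s \<bullet> (B *v s)) / (s \<bullet> (P *v s)) - 1)
    \<le> bfgs_potential P B - bfgs_potential P (bfgs_update B s y)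
      + (y \<bullet> (matrix_inv P *v y)) / (s \<bullet> y) - 1 - ln ((s \<bullet> y) / (s \<bullet> (P *v s)))"
proof -
  define b e S where "b = s \<bullet> (B *v s)" and "e = (B *v s) \<bullet> (matrix_inv P *v (B *v s))" and "S = s \<bullet> (P *v s)"
  have b: "b > 0" using spd_pos[OF B s] by (simp add: b_def)
  have S: "S > 0" using spd_pos[OF P s] by (simp add: S_def)
  have "b\<^sup>2 \<le> e * S" using dual_norms_Cauchy_Schwarz[OF P, of "B *v s" s] by (simp add: b_def e_def S_def inner_commute)
  hence "b / S \<le> e / b" using b S by (simp add: field_simps power2_eq_square)
  moreover have "ln (s \<bullet> y / b) - ln (s \<bullet> y / S) = - ln (b / S)"
    using b S sy by (simp add: ln_div)
  ultimately show ?thesis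
    unfolding potential_bfgs_update[OF assms] omega_def by (simp flip: b_def e_def S_def)
qed

text \<open>
An update with \<open>y = P s\<close> does not increase the potential, and the chain of such updates ends in \<open>P\<close>,
where the potential vanishes.
\<close>

lemma potential_nonneg:
  fixes P B :: "real^'n^'n"
  assumes P: "sym_pos_def P" and B: "sym_pos_def B"
  shows "bfgs_potential P B \<ge> 0"
proof (rule spd_bfgs_induct[OF P B, where Q = "\<lambda>B. bfgs_potential P B \<ge> 0"])
  have "matrix_inv P ** P = mat 1" using spd_invertible[OF P] by (simp add: invertible_inverse)
  thus "bfgs_potential P P \<ge> 0" using spd_det_pos[OF P] by (simp add: bfgs_potential_def trace_I)
next
  fix B :: "real^'n^'n" and s :: "real^'n"
  assume B: "sym_pos_def B" and s: "s \<noteq> 0" and IH: "bfgs_potential P (bfgs_update B s (P *v s)) \<ge> 0"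
  have S: "s \<bullet> (P *v s) > 0" using spd_pos[OF P s] .
  have "(s \<bullet> (B *v s)) / (s \<bullet> (P *v s)) > 0" using S spd_pos[OF B s] by simp
  from ln_le_self_minus_one[OF this] have "omega ((s \<bullet> (B *v s)) / (s \<bullet> (P *v s)) - 1) \<ge> 0"
    by (simp add: omega_def)
  thus "bfgs_potential P B \<ge> 0"
    using potential_decrease_omega[OF P B s S] IH S by (simp add: spd_inv_cancel[OF P] inner_commute)
qed

lemma spd_scaleR:
  assumes "sym_pos_def A" "c > 0" shows "sym_pos_def (c *\<^sub>R A)"
proof -
  have "transpose (c *\<^sub>R A) = c *\<^sub>R transpose A" by (simp add: transpose_def vec_eq_iff)
  thus ?thesis using assms by (simp add: sym_pos_def_def scaleR_matrix_vector_assoc[symmetric])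
qed

lemma scaleR_mat_1_vec: "(c *\<^sub>R mat 1 :: real^'n^'n) *v v = c *\<^sub>R v"
  by (simp add: scaleR_matrix_vector_assoc[symmetric])

lemma matrix_inv_scaled_identity_vec:
  assumes "c > 0"
  shows "matrix_inv (c *\<^sub>R mat 1 :: real^'n^'n) *v v = (1 / c) *\<^sub>R v"
proof -
  have "sym_pos_def (c *\<^sub>R mat 1 :: real^'n^'n)" using spd_scaleR[OF spd_mat_1 assms] .
  from spd_inv_cancel(2)[OF this, of "(1 / c) *\<^sub>R v"] assms show ?thesis
    by (simp add: scaleR_mat_1_vec)
qed

lemma det_scaled_identity: "det (c *\<^sub>R mat 1 :: real^'n^'n) = c ^ CARD('n)"
proof -
  have "det (c *\<^sub>R mat 1 :: real^'n^'n) = (\<Prod>i\<in>(UNIV::'n set). (c *\<^sub>R mat 1 :: real^'n^'n) $ i $ i)"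
    by (rule det_diagonal) (simp add: mat_def)
  thus ?thesis by (simp add: mat_def)
qed

text \<open>
The potential of \<open>H\<close> relative to \<open>c I\<close> is nonnegative, and its trace part is at most the dimension.
\<close>

lemma spd_det_le_power:
  fixes H :: "real^'n^'n"
  assumes H: "sym_pos_def H" and c: "c > 0" and le: "\<And>v. v \<bullet> (H *v v) \<le> c * (v \<bullet> v)"
  shows "ln (det H) \<le> real CARD('n) * ln c"
proof -
  have "H $ i $ i \<le> c" for i
  proof -
    have "axis i 1 \<bullet> (H *v axis i 1) \<le> c" using le[of "axis i 1"] by (simp add: inner_axis_axis)
    thus ?thesis by (simp add: inner_axis' matrix_vector_mult_basis column_def)
  qed
  hence "trace H \<le> real CARD('n) * c" unfolding trace_def using sum_bounded_above[of UNIV "\<lambda>i. H$i$i" c] by simp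
  moreover have "matrix_inv (c *\<^sub>R mat 1) ** H = (1 / c) *\<^sub>R H"
    by (rule matrix_eq_if_all_vec)
       (simp add: matrix_vector_mul_assoc[symmetric] matrix_inv_scaled_identity_vec[OF c] scaleR_matrix_vector_assoc[symmetric])
  ultimately have "trace (matrix_inv (c *\<^sub>R mat 1) ** H) \<le> real CARD('n)"
    using c by (simp add: trace_scaleR field_simps)
  hence "ln (det H / c ^ CARD('n)) \<le> 0"
    using potential_nonneg[OF spd_scaleR[OF spd_mat_1 c] H] by (simp add: bfgs_potential_def det_scaled_identity)
  thus ?thesis using spd_det_pos[OF H] c by (simp add: ln_div ln_realpow)
qed

lemma potential_scaled_identity_le:
  fixes H :: "real^'n^'n"
  assumes H: "sym_pos_def H" and c: "c > 0" and \<mu>: "\<mu> > 0"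
    and lower: "\<And>v. \<mu> * (v \<bullet> v) \<le> v \<bullet> (H *v v)" and upper: "\<And>v. v \<bullet> (H *v v) \<le> L * (v \<bullet> v)"
    and L: "L > 0"
  shows "bfgs_potential H (c *\<^sub>R mat 1) \<le> real CARD('n) * (c / \<mu> - 1 + ln (L / c))"
proof -
  have "v \<bullet> (matrix_inv H *v v) \<le> (v \<bullet> v) / \<mu>" for v
  proof -
    define w where "w = matrix_inv H *v v"
    have "0 \<le> (v - \<mu> *\<^sub>R w) \<bullet> (v - \<mu> *\<^sub>R w)" by simp
    also have "\<dots> = v \<bullet> v - \<mu> * (v \<bullet> w) - \<mu> * (v \<bullet> w - \<mu> * (w \<bullet> w))"
      by (simp add: inner_diff_left inner_diff_right inner_commute algebra_simps)
    finally have *: "\<mu> * (v \<bullet> w) + \<mu> * (v \<bullet> w - \<mu> * (w \<bullet> w)) \<le> v \<bullet> v" by simp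
    have "v \<bullet> w - \<mu> * (w \<bullet> w) \<ge> 0"
      using lower[of w] by (simp add: w_def spd_inv_cancel[OF H] inner_commute)
    hence "\<mu> * (v \<bullet> w - \<mu> * (w \<bullet> w)) \<ge> 0" using \<mu> by simp
    with * have "\<mu> * (v \<bullet> w) \<le> v \<bullet> v" by linarith
    thus ?thesis using \<mu> by (simp add: w_def field_simps)
  qed
  from this[of "axis i 1" for i] have "matrix_inv H $ i $ i \<le> 1 / \<mu>" for i
    by (simp add: inner_axis' matrix_vector_mult_basis column_def)
  hence "trace (matrix_inv H) \<le> real CARD('n) * (1 / \<mu>)"
    unfolding trace_def using sum_bounded_above[of UNIV "\<lambda>i. matrix_inv H$i$i" "1/\<mu>"] by simp
  moreover have "matrix_inv H ** (c *\<^sub>R mat 1) = c *\<^sub>R matrix_inv H"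
    by (rule matrix_eq_if_all_vec)
       (simp add: matrix_vector_mul_assoc[symmetric] scaleR_mat_1_vec scaleR_matrix_vector_assoc[symmetric] matrix_vector_mult_scaleR)
  ultimately have "trace (matrix_inv H ** (c *\<^sub>R mat 1)) \<le> real CARD('n) * (c / \<mu>)"
    using mult_left_mono[of "trace (matrix_inv H)" "real CARD('n) * (1 / \<mu>)" c] c by (simp add: trace_scaleR mult_ac)
  moreover have "- ln (c ^ CARD('n) / det H) \<le> real CARD('n) * ln (L / c)"
    using spd_det_le_power[OF H L upper] c spd_det_pos[OF H] L by (simp add: ln_div ln_realpow algebra_simps)
  ultimately show ?thesis
    by (simp add: bfgs_potential_def det_scaled_identity algebra_simps)
qed

section \<open>Strongly convex functions with a Lipschitz Hessian\<close>

lemma has_derivative_gradient: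
  fixes f :: "'a::euclidean_space \<Rightarrow> real"
  assumes "f differentiable (at x)"
  shows "(f has_derivative (\<lambda>h. h \<bullet> gradient f x)) (at x)"
proof -
  obtain f' where f': "(f has_derivative f') (at x)" using assms by (auto simp: differentiable_def)
  have "f' h = h \<bullet> adjoint f' 1" for h
    using adjoint_works[OF has_derivative_linear[OF f'], of h 1] by simp
  hence "f' = (\<lambda>h. h \<bullet> adjoint f' 1)" by auto
  hence ex: "GDERIV f x :> adjoint f' 1" unfolding gderiv_def using f' by argo
  have "D = adjoint f' 1" if "GDERIV f x :> D" for D
    using has_derivative_unique[OF that[unfolded gderiv_def] ex[unfolded gderiv_def]]
    by (metis vector_eq_rdot inner_commute)
  hence "gradient f x = adjoint f' 1" unfolding gradient_def using ex by (blast intro: the_equality)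
  thus ?thesis using ex by (simp add: gderiv_def)
qed

lemma has_derivative_hessian:
  assumes "gradient f differentiable (at x)"
  shows "(gradient f has_derivative (\<lambda>h. hessian f x *v h)) (at x)"
proof -
  have *: "(gradient f has_derivative frechet_derivative (gradient f) (at x)) (at x)"
    using assms by (simp add: frechet_derivative_works)
  have "(\<lambda>h. hessian f x *v h) = frechet_derivative (gradient f) (at x)"
    unfolding hessian_def using matrix_vector_mul(2)[OF has_derivative_linear[OF *]] by simp
  thus ?thesis using * by simp
qed

lemma derivative_ge_if_growth:
  fixes \<phi> :: "real \<Rightarrow> real"
  assumes D: "(\<phi> has_real_derivative D) (at 0)"
    and le: "\<And>h. 0 < h \<Longrightarrow> h \<le> 1 \<Longrightarrow> c * h \<le> \<phi> h - \<phi> 0"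
  shows "c \<le> D"
proof (rule tendsto_lowerbound)
  have "((\<lambda>h. (\<phi> (0 + h) - \<phi> 0) / h) \<longlongrightarrow> D) (at 0)" using D by (simp add: DERIV_def)
  thus "((\<lambda>h. (\<phi> h - \<phi> 0) / h) \<longlongrightarrow> D) (at_right 0)"
    by (auto intro: tendsto_mono[OF at_le])
  have "eventually (\<lambda>h::real. 0 < h \<and> h < 1) (at_right 0)"
    by (auto simp: eventually_at_right_field intro!: exI[of _ 1])
  thus "eventually (\<lambda>h. c \<le> (\<phi> h - \<phi> 0) / h) (at_right 0)"
    by eventually_elim (use le in \<open>auto simp: field_simps\<close>)
qed simp

lemma unit_interval_nondecreasing:
  fixes \<phi> :: "real \<Rightarrow> real"
  assumes "\<And>\<tau>. 0 \<le> \<tau> \<Longrightarrow> \<tau> \<le> 1 \<Longrightarrow> (\<phi> has_real_derivative \<phi>' \<tau>) (at \<tau>)"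
    and "\<And>\<tau>. 0 \<le> \<tau> \<Longrightarrow> \<tau> \<le> 1 \<Longrightarrow> 0 \<le> \<phi>' \<tau>" and "0 \<le> b" "b \<le> 1"
  shows "\<phi> 0 \<le> \<phi> b"
  by (rule DERIV_nonneg_imp_nondecreasing[OF assms(3)]) (use assms in force)

locale smooth_strongly_convex =
  fixes f :: "real^'n \<Rightarrow> real" and \<mu> L M :: real and xs :: "real^'n"
  assumes twice: "twice_differentiable f"
    and mu_pos: "\<mu> > 0" and strong: "strongly_convex \<mu> f"
    and L_pos: "L > 0" and lipschitz: "L-lipschitz_on UNIV (gradient f)"
    and M_pos: "M > 0" and hess_lipschitz: "hessian_lipschitz M f"
    and minimizer: "\<And>y. f xs \<le> f y"
begin

abbreviation g where "g \<equiv> gradient f"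
abbreviation H where "H \<equiv> hessian f"

lemma f_line_derivative:
  "((\<lambda>\<tau>. f (x + \<tau> *\<^sub>R v)) has_real_derivative v \<bullet> g (x + \<tau> *\<^sub>R v)) (at \<tau>)"
proof -
  have 1: "((\<lambda>\<tau>. x + \<tau> *\<^sub>R v) has_derivative (\<lambda>h. h *\<^sub>R v)) (at \<tau>)"
    by (auto intro!: derivative_eq_intros)
  have 2: "(f has_derivative (\<lambda>h. h \<bullet> g (x + \<tau> *\<^sub>R v))) (at (x + \<tau> *\<^sub>R v))"
    using twice by (intro has_derivative_gradient) (simp add: twice_differentiable_def)
  from has_derivative_compose[OF 1 2] show ?thesis
    by (simp add: has_field_derivative_def mult_commute_abs)
qed

lemma gradient_line_derivative:
  "((\<lambda>\<tau>. u \<bullet> g (x + \<tau> *\<^sub>R v)) has_real_derivative u \<bullet> (H (x + \<tau> *\<^sub>R v) *v v)) (at \<tau>)"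
proof -
  have 1: "((\<lambda>\<tau>. x + \<tau> *\<^sub>R v) has_derivative (\<lambda>h. h *\<^sub>R v)) (at \<tau>)"
    by (auto intro!: derivative_eq_intros)
  have 2: "(g has_derivative (\<lambda>h. H (x + \<tau> *\<^sub>R v) *v h)) (at (x + \<tau> *\<^sub>R v))"
    using twice by (intro has_derivative_hessian) (simp add: twice_differentiable_def)
  from has_derivative_inner_right[OF has_derivative_compose[OF 1 2], of u] show ?thesis
    by (simp add: has_field_derivative_def mult_commute_abs matrix_vector_mult_scaleR)
qed

lemma hessian_form_lipschitz:
  "\<bar>u \<bullet> (H x *v v) - u \<bullet> (H y *v v)\<bar> \<le> M * norm (x - y) * (norm u * norm v)"
proof -
  have "\<bar>u \<bullet> ((H x - H y) *v v)\<bar> \<le> norm u * norm ((H x - H y) *v v)" by (rule Cauchy_Schwarz_ineq2)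
  also have "\<dots> \<le> norm u * (onorm (\<lambda>v. (H x - H y) *v v) * norm v)"
    by (intro mult_left_mono onorm) auto
  also have "\<dots> \<le> norm u * (M * norm (x - y) * norm v)"
    using hess_lipschitz by (intro mult_left_mono mult_right_mono) (auto simp: hessian_lipschitz_def)
  finally show ?thesis
    by (simp add: matrix_vector_mult_diff_rdistrib inner_diff_right mult_ac)
qed

text \<open>
The mean value theorem along \<open>v\<close> for the difference of \<open>f\<close> in direction \<open>u\<close>, and then along \<open>u\<close> for the
gradient. The left side is symmetric in \<open>u\<close> and \<open>v\<close>, which is the source of the symmetry of the
Hessian.
\<close>

lemma second_difference:
  assumes t: "t > 0"
  shows "\<exists>z. norm (z - x) \<le> t * (norm u + norm v) \<and>
    f (x + t *\<^sub>R u + t *\<^sub>R v) - f (x + t *\<^sub>R u) - f (x + t *\<^sub>R v) + f x = t\<^sup>2 * (v \<bullet> (H z *v u))"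
proof -
  define \<phi> where "\<phi> \<theta> = f (x + t *\<^sub>R u + \<theta> *\<^sub>R v) - f (x + \<theta> *\<^sub>R v)" for \<theta>
  have "\<exists>\<theta>>0. \<theta> < t \<and> \<phi> t - \<phi> 0 = (t - 0) * (v \<bullet> g (x + t *\<^sub>R u + \<theta> *\<^sub>R v) - v \<bullet> g (x + \<theta> *\<^sub>R v))"
    unfolding \<phi>_def using t by (intro MVT2 DERIV_diff f_line_derivative)
  then obtain \<theta> where \<theta>: "0 < \<theta>" "\<theta> < t"
    and 1: "\<phi> t - \<phi> 0 = t * (v \<bullet> g (x + t *\<^sub>R u + \<theta> *\<^sub>R v) - v \<bullet> g (x + \<theta> *\<^sub>R v))" by auto
  have "\<exists>\<xi>>0. \<xi> < t \<and> v \<bullet> g (x + \<theta> *\<^sub>R v + t *\<^sub>R u) - v \<bullet> g (x + \<theta> *\<^sub>R v + 0 *\<^sub>R u)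
      = (t - 0) * (v \<bullet> (H (x + \<theta> *\<^sub>R v + \<xi> *\<^sub>R u) *v u))"
    using t by (intro MVT2 gradient_line_derivative)
  then obtain \<xi> where \<xi>: "0 < \<xi>" "\<xi> < t"
    and 2: "v \<bullet> g (x + \<theta> *\<^sub>R v + t *\<^sub>R u) - v \<bullet> g (x + \<theta> *\<^sub>R v)
      = t * (v \<bullet> (H (x + \<theta> *\<^sub>R v + \<xi> *\<^sub>R u) *v u))" by auto
  let ?z = "x + \<theta> *\<^sub>R v + \<xi> *\<^sub>R u"
  have "norm (?z - x) \<le> \<theta> * norm v + \<xi> * norm u"
    using norm_triangle_ineq[of "\<theta> *\<^sub>R v" "\<xi> *\<^sub>R u"] \<theta> \<xi> by simp
  also have "\<dots> \<le> t * norm v + t * norm u"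
    using \<theta> \<xi> by (intro add_mono mult_right_mono) auto
  finally have "norm (?z - x) \<le> t * (norm u + norm v)" by (simp add: algebra_simps)
  moreover have "f (x + t *\<^sub>R u + t *\<^sub>R v) - f (x + t *\<^sub>R u) - f (x + t *\<^sub>R v) + f x = t\<^sup>2 * (v \<bullet> (H ?z *v u))"
    using 1 2 by (simp add: \<phi>_def algebra_simps power2_eq_square)
  ultimately show ?thesis by blast
qed

lemma hessian_inner_swap: "u \<bullet> (H x *v v) = (H x *v u) \<bullet> v"
proof -
  define K where "K = 2 * M * (norm u + norm v) * (norm u * norm v)"
  define a where "a = \<bar>v \<bullet> (H x *v u) - u \<bullet> (H x *v v)\<bar>"
  have K: "K \<ge> 0" using M_pos by (simp add: K_def)
  have bound: "a \<le> K * t" if t: "t > 0" for t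
  proof -
    obtain z where z: "norm (z - x) \<le> t * (norm u + norm v)"
      "f (x + t *\<^sub>R u + t *\<^sub>R v) - f (x + t *\<^sub>R u) - f (x + t *\<^sub>R v) + f x = t\<^sup>2 * (v \<bullet> (H z *v u))"
      using second_difference[OF t] by blast
    obtain w where w: "norm (w - x) \<le> t * (norm v + norm u)"
      "f (x + t *\<^sub>R v + t *\<^sub>R u) - f (x + t *\<^sub>R v) - f (x + t *\<^sub>R u) + f x = t\<^sup>2 * (u \<bullet> (H w *v v))"
      using second_difference[OF t] by blast
    have "x + t *\<^sub>R v + t *\<^sub>R u = x + t *\<^sub>R u + t *\<^sub>R v" by simp
    hence "t\<^sup>2 * (v \<bullet> (H z *v u)) = t\<^sup>2 * (u \<bullet> (H w *v v))" using z(2) w(2) by (simp only:)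
    hence eq: "v \<bullet> (H z *v u) = u \<bullet> (H w *v v)" using t by simp
    have "\<bar>v \<bullet> (H z *v u) - v \<bullet> (H x *v u)\<bar> \<le> M * (t * (norm u + norm v)) * (norm v * norm u)"
      using hessian_form_lipschitz[of v z u x] z(1) M_pos
      by (meson mult_left_mono mult_right_mono order_trans less_imp_le norm_ge_zero mult_nonneg_nonneg)
    moreover have "\<bar>u \<bullet> (H w *v v) - u \<bullet> (H x *v v)\<bar> \<le> M * (t * (norm v + norm u)) * (norm u * norm v)"
      using hessian_form_lipschitz[of u w v x] w(1) M_pos
      by (meson mult_left_mono mult_right_mono order_trans less_imp_le norm_ge_zero mult_nonneg_nonneg)
    ultimately have "a \<le> M * (t * (norm u + norm v)) * (norm v * norm u) + M * (t * (norm v + norm u)) * (norm u * norm v)"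
      unfolding a_def using eq by linarith
    also have "\<dots> = K * t" by (simp add: K_def algebra_simps)
    finally show ?thesis .
  qed
  have "a \<le> 0 + e" if "e > 0" for e
  proof -
    have "a \<le> K * (e / (K + 1))" using bound[of "e / (K + 1)"] that K by simp
    also have "\<dots> \<le> e" using that K by (simp add: field_simps)
    finally show ?thesis by simp
  qed
  hence "a \<le> 0" by (rule field_le_epsilon)
  thus ?thesis by (simp add: a_def inner_commute)
qed

lemma hessian_symmetric: "transpose (H x) = H x"
  by (rule transpose_eq_if_inner_swap) (rule hessian_inner_swap)

lemma segment_below:
  assumes "f a \<le> c" "f b \<le> c" "0 \<le> \<tau>" "\<tau> \<le> 1"
  shows "f (a + \<tau> *\<^sub>R (b - a)) \<le> c"
proof -
  have "f (\<tau> *\<^sub>R b + (1 - \<tau>) *\<^sub>R a) \<le> \<tau> * f b + (1 - \<tau>) * f a - \<mu> / 2 * \<tau> * (1 - \<tau>) * (norm (b - a))\<^sup>2"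
    using strong assms(3,4) by (simp add: strongly_convex_def)
  also have "\<dots> \<le> \<tau> * f b + (1 - \<tau>) * f a" using assms(3,4) mu_pos by simp
  also have "\<dots> \<le> \<tau> * c + (1 - \<tau>) * c" using assms by (intro add_mono mult_left_mono) auto
  also have "\<tau> *\<^sub>R b + (1 - \<tau>) *\<^sub>R a = a + \<tau> *\<^sub>R (b - a)" by (simp add: algebra_simps)
  finally show ?thesis by (simp add: algebra_simps)
qed

lemma strong_convexity_first_order:
  "f x + w \<bullet> g x + \<mu> / 2 * (w \<bullet> w) \<le> f (x + w)"
proof -
  define \<phi> where "\<phi> h = - f (x + h *\<^sub>R w) + \<mu> / 2 * h\<^sup>2 * (w \<bullet> w)" for h :: real
  have D: "(\<phi> has_real_derivative - (w \<bullet> g (x + 0 *\<^sub>R w)) + \<mu> / 2 * (2 * 0) * (w \<bullet> w)) (at 0)"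
    unfolding \<phi>_def by (rule derivative_eq_intros f_line_derivative | simp)+
  have "f x - f (x + w) + \<mu> / 2 * (w \<bullet> w) \<le> - (w \<bullet> g (x + 0 *\<^sub>R w)) + \<mu> / 2 * (2 * 0) * (w \<bullet> w)"
  proof (rule derivative_ge_if_growth[OF D])
    fix h :: real assume h: "0 < h" "h \<le> 1"
    have "f (h *\<^sub>R (x + w) + (1 - h) *\<^sub>R x)
        \<le> h * f (x + w) + (1 - h) * f x - \<mu> / 2 * h * (1 - h) * (norm (x + w - x))\<^sup>2"
      using strong[unfolded strongly_convex_def, rule_format, of h "x + w" x] h by simp
    moreover have sq: "(norm (x + w - x))\<^sup>2 = w \<bullet> w" by (simp add: power2_norm_eq_inner)
    moreover have pt: "h *\<^sub>R (x + w) + (1 - h) *\<^sub>R x = x + h *\<^sub>R w" by (simp add: algebra_simps)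
    ultimately have "f (x + h *\<^sub>R w) \<le> h * f (x + w) + (1 - h) * f x - \<mu> / 2 * h * (1 - h) * (w \<bullet> w)"
      by (simp only: sq pt)
    thus "(f x - f (x + w) + \<mu> / 2 * (w \<bullet> w)) * h \<le> \<phi> h - \<phi> 0"
      by (simp add: \<phi>_def algebra_simps power2_eq_square diff_divide_distrib)
  qed
  thus ?thesis by simp
qed

lemma gradient_minimizer: "g xs = 0"
proof -
  have D: "((\<lambda>h. f (xs + h *\<^sub>R (- g xs))) has_real_derivative (- g xs) \<bullet> g (xs + 0 *\<^sub>R (- g xs))) (at 0)"
    by (rule f_line_derivative)
  have "0 \<le> (- g xs) \<bullet> g (xs + 0 *\<^sub>R (- g xs))"
    by (rule derivative_ge_if_growth[OF D]) (simp add: minimizer)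
  thus ?thesis using inner_ge_zero[of "g xs"] inner_eq_zero_iff[of "g xs"] by auto
qed

lemma sublevel_distance: "\<mu> * (norm (z - xs))\<^sup>2 \<le> 2 * (f z - f xs)"
  using strong_convexity_first_order[of xs "z - xs"]
  by (simp add: gradient_minimizer power2_norm_eq_inner)

lemma hessian_lower: "\<mu> * (v \<bullet> v) \<le> v \<bullet> (H x *v v)"
proof -
  have D: "((\<lambda>h. v \<bullet> g (x + h *\<^sub>R v)) has_real_derivative v \<bullet> (H (x + 0 *\<^sub>R v) *v v)) (at 0)"
    by (rule gradient_line_derivative)
  have "\<mu> * (v \<bullet> v) \<le> v \<bullet> (H (x + 0 *\<^sub>R v) *v v)"
  proof (rule derivative_ge_if_growth[OF D])
    fix h :: real assume h: "0 < h" "h \<le> 1"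
    have "h * (\<mu> * (v \<bullet> v) * h) \<le> h * (v \<bullet> g (x + h *\<^sub>R v) - v \<bullet> g (x + 0 *\<^sub>R v))"
      using strong_convexity_first_order[of x "h *\<^sub>R v"]
        strong_convexity_first_order[of "x + h *\<^sub>R v" "- (h *\<^sub>R v)"]
      by (simp add: algebra_simps)
    thus "\<mu> * (v \<bullet> v) * h \<le> v \<bullet> g (x + h *\<^sub>R v) - v \<bullet> g (x + 0 *\<^sub>R v)" using h by simp
  qed
  thus ?thesis by simp
qed

lemma hessian_upper: "v \<bullet> (H x *v v) \<le> L * (v \<bullet> v)"
proof -
  have D: "((\<lambda>h. (- v) \<bullet> g (x + h *\<^sub>R v)) has_real_derivative (- v) \<bullet> (H (x + 0 *\<^sub>R v) *v v)) (at 0)"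
    by (rule gradient_line_derivative)
  have "- (L * (v \<bullet> v)) \<le> (- v) \<bullet> (H (x + 0 *\<^sub>R v) *v v)"
  proof (rule derivative_ge_if_growth[OF D])
    fix h :: real assume h: "0 < h" "h \<le> 1"
    have "norm (g (x + h *\<^sub>R v) - g x) \<le> L * norm (h *\<^sub>R v)"
      using lipschitz_onD[OF lipschitz, of "x + h *\<^sub>R v" x] by (simp add: dist_norm)
    hence "norm v * norm (g (x + h *\<^sub>R v) - g x) \<le> norm v * (L * norm (h *\<^sub>R v))"
      by (rule mult_left_mono) simp
    hence "v \<bullet> (g (x + h *\<^sub>R v) - g x) \<le> L * h * (v \<bullet> v)"
      using norm_cauchy_schwarz[of v "g (x + h *\<^sub>R v) - g x"] h
      by (simp add: power2_norm_eq_inner[symmetric] power2_eq_square mult_ac)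
    thus "- (L * (v \<bullet> v)) * h \<le> (- v) \<bullet> g (x + h *\<^sub>R v) - (- v) \<bullet> g (x + 0 *\<^sub>R v)"
      by (simp add: algebra_simps)
  qed
  thus ?thesis by simp
qed

lemma hessian_spd: "sym_pos_def (H x)"
  unfolding sym_pos_def_def
proof (intro conjI allI impI hessian_symmetric)
  fix v :: "real^'n" assume "v \<noteq> 0"
  hence "0 < \<mu> * (v \<bullet> v)" using mu_pos by simp
  thus "0 < v \<bullet> (H x *v v)" using hessian_lower[of v x] by linarith
qed

lemma mu_le_L: "\<mu> \<le> L"
proof -
  obtain v :: "real^'n" where "v \<in> Basis" using nonempty_Basis by blast
  hence "v \<bullet> v = 1" by simp
  thus ?thesis using hessian_lower[of v 0] hessian_upper[of v 0] by simp
qed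

lemma taylor_lower:
  assumes "\<And>\<tau>. 0 \<le> \<tau> \<Longrightarrow> \<tau> \<le> 1 \<Longrightarrow> c \<le> v \<bullet> (H (x + \<tau> *\<^sub>R v) *v v)"
  shows "c \<le> v \<bullet> (g (x + v) - g x)" and "c / 2 \<le> f (x + v) - f x - v \<bullet> g x"
proof -
  have grad: "c * b \<le> v \<bullet> (g (x + b *\<^sub>R v) - g x)" if "0 \<le> b" "b \<le> 1" for b
  proof -
    have "v \<bullet> g (x + 0 *\<^sub>R v) - c * 0 \<le> v \<bullet> g (x + b *\<^sub>R v) - c * b"
    proof (rule unit_interval_nondecreasing[where \<phi>' = "\<lambda>\<tau>. v \<bullet> (H (x + \<tau> *\<^sub>R v) *v v) - c"])
      show "((\<lambda>\<tau>. v \<bullet> g (x + \<tau> *\<^sub>R v) - c * \<tau>) has_real_derivative v \<bullet> (H (x + \<tau> *\<^sub>R v) *v v) - c) (at \<tau>)" for \<tau>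
        by (rule derivative_eq_intros gradient_line_derivative | simp)+
    qed (use assms that in auto)
    thus ?thesis by (simp add: inner_diff_right)
  qed
  show "c \<le> v \<bullet> (g (x + v) - g x)" using grad[of 1] by simp
  have "f (x + 0 *\<^sub>R v) - 0 * (v \<bullet> g x) - c * 0\<^sup>2 / 2 \<le> f (x + 1 *\<^sub>R v) - 1 * (v \<bullet> g x) - c * 1\<^sup>2 / 2"
  proof (rule unit_interval_nondecreasing[where \<phi>' = "\<lambda>\<tau>. v \<bullet> g (x + \<tau> *\<^sub>R v) - v \<bullet> g x - c * \<tau>"])
    show "((\<lambda>\<tau>. f (x + \<tau> *\<^sub>R v) - \<tau> * (v \<bullet> g x) - c * \<tau>\<^sup>2 / 2) has_real_derivative
        v \<bullet> g (x + \<tau> *\<^sub>R v) - v \<bullet> g x - c * \<tau>) (at \<tau>)" for \<tau>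
      by (rule derivative_eq_intros f_line_derivative | simp)+
  qed (use grad in \<open>auto simp: inner_diff_right\<close>)
  thus "c / 2 \<le> f (x + v) - f x - v \<bullet> g x" by simp
qed

lemma taylor_upper:
  assumes "\<And>\<tau>. 0 \<le> \<tau> \<Longrightarrow> \<tau> \<le> 1 \<Longrightarrow> v \<bullet> (H (x + \<tau> *\<^sub>R v) *v v) \<le> c"
  shows "f (x + v) - f x - v \<bullet> g x \<le> c / 2"
proof -
  have grad: "v \<bullet> (g (x + b *\<^sub>R v) - g x) \<le> c * b" if "0 \<le> b" "b \<le> 1" for b
  proof -
    have "c * 0 - v \<bullet> g (x + 0 *\<^sub>R v) \<le> c * b - v \<bullet> g (x + b *\<^sub>R v)"
    proof (rule unit_interval_nondecreasing[where \<phi>' = "\<lambda>\<tau>. c - v \<bullet> (H (x + \<tau> *\<^sub>R v) *v v)"])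
      show "((\<lambda>\<tau>. c * \<tau> - v \<bullet> g (x + \<tau> *\<^sub>R v)) has_real_derivative c - v \<bullet> (H (x + \<tau> *\<^sub>R v) *v v)) (at \<tau>)" for \<tau>
        by (rule derivative_eq_intros gradient_line_derivative | simp)+
    qed (use assms that in auto)
    thus ?thesis by (simp add: inner_diff_right)
  qed
  have "c * 0\<^sup>2 / 2 - f (x + 0 *\<^sub>R v) + 0 * (v \<bullet> g x) \<le> c * 1\<^sup>2 / 2 - f (x + 1 *\<^sub>R v) + 1 * (v \<bullet> g x)"
  proof (rule unit_interval_nondecreasing[where \<phi>' = "\<lambda>\<tau>. c * \<tau> - v \<bullet> g (x + \<tau> *\<^sub>R v) + v \<bullet> g x"])
    show "((\<lambda>\<tau>. c * \<tau>\<^sup>2 / 2 - f (x + \<tau> *\<^sub>R v) + \<tau> * (v \<bullet> g x)) has_real_derivative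
        c * \<tau> - v \<bullet> g (x + \<tau> *\<^sub>R v) + v \<bullet> g x) (at \<tau>)" for \<tau>
      by (rule derivative_eq_intros f_line_derivative | simp)+
  qed (use grad in \<open>auto simp: inner_diff_right algebra_simps\<close>)
  thus ?thesis by simp
qed

text \<open>
With \<open>v = P\<^sup>-\<^sup>1 y\<close> and \<open>N = v \<bullet> P v = y \<bullet> v\<close>, the derivative of \<open>\<tau> \<mapsto> v \<bullet> g (x + \<tau> s)\<close> is at most
\<open>c / 2\<close> times that of \<open>\<tau> \<mapsto> s \<bullet> g (x + \<tau> s)\<close> plus \<open>N / 2\<close>, by Cauchy-Schwarz for the form of the
Hessian. Integration gives \<open>N \<le> c / 2 (s \<bullet> y) + N / 2\<close>. Only points of the segment enter, in contrast
to the usual proof by a descent step.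
\<close>

lemma weighted_cocoercivity:
  assumes P: "sym_pos_def P" and c: "c > 0"
    and upper: "\<And>\<tau> v. 0 \<le> \<tau> \<Longrightarrow> \<tau> \<le> 1 \<Longrightarrow> v \<bullet> (H (x + \<tau> *\<^sub>R s) *v v) \<le> c * (v \<bullet> (P *v v))"
  defines "y \<equiv> g (x + s) - g x"
  shows "y \<bullet> (matrix_inv P *v y) \<le> c * (s \<bullet> y)"
proof -
  define v N where "v = matrix_inv P *v y" and "N = y \<bullet> (matrix_inv P *v y)"
  have vPv: "v \<bullet> (P *v v) = N" by (simp add: v_def N_def spd_inv_cancel[OF P] inner_commute)
  have "c / 2 * (s \<bullet> g (x + 0 *\<^sub>R s)) + N / 2 * 0 - v \<bullet> g (x + 0 *\<^sub>R s)
      \<le> c / 2 * (s \<bullet> g (x + 1 *\<^sub>R s)) + N / 2 * 1 - v \<bullet> g (x + 1 *\<^sub>R s)"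
  proof (rule unit_interval_nondecreasing[where
        \<phi>' = "\<lambda>\<tau>. c / 2 * (s \<bullet> (H (x + \<tau> *\<^sub>R s) *v s)) + N / 2 - v \<bullet> (H (x + \<tau> *\<^sub>R s) *v s)"])
    fix \<tau> :: real assume \<tau>: "0 \<le> \<tau>" "\<tau> \<le> 1"
    show "((\<lambda>\<tau>. c / 2 * (s \<bullet> g (x + \<tau> *\<^sub>R s)) + N / 2 * \<tau> - v \<bullet> g (x + \<tau> *\<^sub>R s)) has_real_derivative
        c / 2 * (s \<bullet> (H (x + \<tau> *\<^sub>R s) *v s)) + N / 2 - v \<bullet> (H (x + \<tau> *\<^sub>R s) *v s)) (at \<tau>)"
      by (intro DERIV_diff DERIV_add DERIV_cmult gradient_line_derivative DERIV_cmult_Id)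
    let ?H = "H (x + \<tau> *\<^sub>R s)"
    have "2 * (s \<bullet> (?H *v v)) \<le> c * (s \<bullet> (?H *v s)) + (v \<bullet> (?H *v v)) / c"
      by (rule nonneg_form_Cauchy_Schwarz[OF hessian_symmetric spd_nonneg[OF hessian_spd] c])
    moreover have "(v \<bullet> (?H *v v)) / c \<le> N" using upper[OF \<tau>, of v] c by (simp add: vPv field_simps)
    moreover have "s \<bullet> (?H *v v) = v \<bullet> (?H *v s)" by (metis hessian_inner_swap inner_commute)
    ultimately show "0 \<le> c / 2 * (s \<bullet> (?H *v s)) + N / 2 - v \<bullet> (?H *v s)" by simp
  qed auto
  hence "v \<bullet> y \<le> c / 2 * (s \<bullet> y) + N / 2" by (simp add: y_def inner_diff_right algebra_simps)
  moreover have "v \<bullet> y = N" by (simp add: v_def N_def inner_commute)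
  ultimately show ?thesis by (simp add: N_def)
qed

text \<open>
The quadratic lower model of \<open>f\<close> at \<open>x\<close> is bounded below by its global minimum, which is attained at
the displacement \<open>- P\<^sup>-\<^sup>1 g / c\<close>.
\<close>

lemma weighted_gradient_domination:
  assumes P: "sym_pos_def P" and c: "c > 0"
    and lower: "\<And>\<tau> v. 0 \<le> \<tau> \<Longrightarrow> \<tau> \<le> 1 \<Longrightarrow> c * (v \<bullet> (P *v v)) \<le> v \<bullet> (H (x + \<tau> *\<^sub>R (xs - x)) *v v)"
  shows "2 * c * (f x - f xs) \<le> g x \<bullet> (matrix_inv P *v g x)"
proof -
  define w u where "w = xs - x" and "u = matrix_inv P *v g x"
  have "c * (w \<bullet> (P *v w)) / 2 \<le> f (x + w) - f x - w \<bullet> g x"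
    by (rule taylor_lower) (use lower in \<open>simp add: w_def\<close>)
  hence 1: "2 * c * (f x - f xs) \<le> 2 * c * (- (w \<bullet> g x) - c * (w \<bullet> (P *v w)) / 2)"
    using c by (intro mult_left_mono) (auto simp: w_def)
  have Pu: "P *v u = g x" by (simp add: u_def spd_inv_cancel[OF P])
  have uw: "u \<bullet> (P *v w) = w \<bullet> g x"
    by (metis Pu inner_commute spd_inner_swap[OF P])
  have "0 \<le> (c *\<^sub>R w + u) \<bullet> (P *v (c *\<^sub>R w + u))" by (rule spd_nonneg[OF P])
  also have "\<dots> = c * c * (w \<bullet> (P *v w)) + 2 * c * (w \<bullet> g x) + g x \<bullet> u"
    by (simp add: matrix_vector_right_distrib matrix_vector_mult_scaleR inner_add_left inner_add_right Pu uw
        inner_commute[of u "g x"] distrib_left distrib_right mult_ac)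
  finally show ?thesis using 1 by (simp add: u_def algebra_simps)
qed

lemma C_const_nonneg: "C_const M \<mu> f xs x \<ge> 0"
  using M_pos minimizer[of x] by (simp add: C_const_def)

text \<open>
On the sublevel set of \<open>x\<close> the distance to the minimizer is at most \<open>sqrt (2 (f x - f xs) / \<mu>)\<close>. The
constant \<open>C\<close> is defined so that \<open>M\<close> times this distance equals \<open>C \<mu>\<close>, and \<open>\<mu> |v|\<^sup>2\<close> is at most the
Hessian form at any point. So the two Hessian forms differ by at most \<open>C\<close> times either of them.
\<close>

lemma hessian_comparison:
  assumes z: "f z \<le> f x"
  shows "v \<bullet> (H z *v v) \<le> (1 + C_const M \<mu> f xs x) * (v \<bullet> (H xs *v v))"
    and "v \<bullet> (H xs *v v) \<le> (1 + C_const M \<mu> f xs x) * (v \<bullet> (H z *v v))"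
proof -
  define C where "C = C_const M \<mu> f xs x"
  have "(norm (z - xs))\<^sup>2 \<le> 2 * (f x - f xs) / \<mu>"
    using sublevel_distance[of z] z mu_pos by (simp add: field_simps)
  hence d: "norm (z - xs) \<le> sqrt (2 * (f x - f xs) / \<mu>)" by (rule real_le_rsqrt)
  have "\<mu> powr (3/2) = \<mu> * sqrt \<mu>"
    using mu_pos powr_add[of \<mu> 1 "1/2"] by (simp add: powr_half_sqrt)
  hence C: "C = M * sqrt (2 * (f x - f xs) / \<mu>) / \<mu>"
    by (simp add: C_def C_const_def real_sqrt_divide)
  have diff: "\<bar>v \<bullet> (H z *v v) - v \<bullet> (H xs *v v)\<bar> \<le> C * (\<mu> * (v \<bullet> v))"
  proof -
    have "\<bar>v \<bullet> (H z *v v) - v \<bullet> (H xs *v v)\<bar> \<le> M * norm (z - xs) * (norm v * norm v)"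
      by (rule hessian_form_lipschitz)
    also have "\<dots> \<le> M * sqrt (2 * (f x - f xs) / \<mu>) * (norm v * norm v)"
      using d M_pos by (intro mult_right_mono mult_left_mono) auto
    also have "\<dots> = C * (\<mu> * (v \<bullet> v))"
      using mu_pos by (simp add: C power2_norm_eq_inner[symmetric] power2_eq_square)
    finally show ?thesis .
  qed
  have "C \<ge> 0" using C_const_nonneg by (simp add: C_def)
  hence "C * (\<mu> * (v \<bullet> v)) \<le> C * (v \<bullet> (H xs *v v))" "C * (\<mu> * (v \<bullet> v)) \<le> C * (v \<bullet> (H z *v v))"
    using hessian_lower by (auto intro!: mult_left_mono)
  thus "v \<bullet> (H z *v v) \<le> (1 + C_const M \<mu> f xs x) * (v \<bullet> (H xs *v v))"
    and "v \<bullet> (H xs *v v) \<le> (1 + C_const M \<mu> f xs x) * (v \<bullet> (H z *v v))"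
    using diff unfolding C_def[symmetric] by (auto simp: algebra_simps)
qed

end

section \<open>The function \<open>\<omega>\<close> and the constants\<close>

lemma omega_upper_bound: "x > -1 \<Longrightarrow> omega x \<le> x\<^sup>2 / (1 + x)"
proof -
  assume x: "x > -1"
  have "- ln (1 + x) \<le> 1 / (1 + x) - 1" using ln_le_minus_one[of "1 / (1 + x)"] x by (simp add: ln_div)
  hence "omega x \<le> x + (1 / (1 + x) - 1)" by (simp add: omega_def)
  also have "\<dots> = x\<^sup>2 / (1 + x)" using x by (simp add: field_simps power2_eq_square)
  finally show ?thesis .
qed

text \<open>
With \<open>r = sqrt \<rho>\<close> the bound \<open>ln r \<le> r - 1\<close> gives \<open>\<omega>(\<rho> - 1) \<ge> (r - 1)\<^sup>2\<close>, and
\<open>(r + 1)\<^sup>2 \<le> 2 + 2 \<rho>\<close>.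
\<close>

lemma square_le_omega:
  assumes "\<rho> > 0"
  shows "(\<rho> - 1)\<^sup>2 \<le> (2 + 2 * \<rho>) * omega (\<rho> - 1)"
proof -
  define r where "r = sqrt \<rho>"
  have r: "r > 0" "\<rho> = r\<^sup>2" using assms by (simp_all add: r_def)
  have "ln \<rho> = 2 * ln r" using r by (simp add: ln_realpow)
  hence "(r - 1)\<^sup>2 \<le> omega (\<rho> - 1)" using ln_le_minus_one[OF r(1)] r(2)
    by (simp add: omega_def power2_eq_square algebra_simps)
  hence "(r - 1)\<^sup>2 * (r + 1)\<^sup>2 \<le> omega (\<rho> - 1) * (r + 1)\<^sup>2" by (rule mult_right_mono) simp
  also have "\<dots> \<le> omega (\<rho> - 1) * (2 + 2 * \<rho>)"
  proof (rule mult_left_mono)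
    have "0 \<le> (r - 1)\<^sup>2" by simp
    thus "(r + 1)\<^sup>2 \<le> 2 + 2 * \<rho>" by (simp add: r(2) power2_eq_square algebra_simps)
    show "0 \<le> omega (\<rho> - 1)" using \<open>(r - 1)\<^sup>2 \<le> omega (\<rho> - 1)\<close> by (meson order_trans zero_le_power2)
  qed
  also have "(r - 1)\<^sup>2 * (r + 1)\<^sup>2 = (\<rho> - 1)\<^sup>2" by (simp add: r(2) power2_eq_square algebra_simps)
  finally show ?thesis by (simp add: mult_ac)
qed

lemma omega_nonneg: "x > -1 \<Longrightarrow> 0 \<le> omega x"
  using ln_le_minus_one[of "1 + x"] by (simp add: omega_def)

lemma omega_antimono:
  assumes "-1 < x" "x \<le> y" "y \<le> 0" shows "omega y \<le> omega x"
proof -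
  have "ln ((1 + x) / (1 + y)) \<le> (1 + x) / (1 + y) - 1" using assms by (intro ln_le_minus_one) simp
  also have "\<dots> = (x - y) / (1 + y)" using assms by (simp add: field_simps)
  also have "\<dots> \<le> x - y"
    using assms mult_left_mono_neg[of "1 + y" 1 "x - y"] by (simp add: field_simps)
  finally show ?thesis using assms by (simp add: omega_def ln_div)
qed

lemma omega_mono:
  assumes "0 \<le> x" "x \<le> y" shows "omega x \<le> omega y"
proof -
  have "ln ((1 + y) / (1 + x)) \<le> (1 + y) / (1 + x) - 1" using assms by (intro ln_le_minus_one) simp
  also have "\<dots> = (y - x) / (1 + x)" using assms by (simp add: field_simps)
  also have "\<dots> \<le> y - x" using assms mult_left_mono[of 1 "1 + x" "y - x"] by (simp add: field_simps)
  finally show ?thesis using assms by (simp add: omega_def ln_div)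
qed

text \<open>
The constant 3 in the final rates, in place of Euler's number, leaves room for the rounding up of the
length of the initial phase; this is the margin that is needed.
\<close>

lemma exp_1_bound: "4 * exp 1 \<le> (11 - 1/8 :: real)"
  using abs_le_D1[OF e_approx_32] by simp

locale wolfe_parameters =
  fixes \<alpha> \<beta> :: real
  assumes alpha_pos: "0 < \<alpha>" and alpha_beta: "\<alpha> < \<beta>" and beta_less: "\<beta> < 1" and alpha_half: "\<alpha> < 1/2"
begin

abbreviation "\<delta>1 \<equiv> delta1 \<alpha> \<beta>"
abbreviation "\<delta>2 \<equiv> delta2 \<alpha> \<beta>"
abbreviation "\<delta>3 \<equiv> delta3 \<alpha> \<beta>"
abbreviation "\<delta>4 \<equiv> delta4 \<alpha> \<beta>"
abbreviation "\<delta>5 \<equiv> delta5 \<alpha> \<beta>"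
abbreviation "\<delta>6 \<equiv> delta6 \<alpha> \<beta>"
abbreviation "\<delta>7 \<equiv> delta7 \<alpha> \<beta>"
abbreviation "\<delta>8 \<equiv> delta8 \<alpha> \<beta>"

lemma sqrt_armijo: "sqrt (2 * (1 - \<alpha>)) > 1" using alpha_half by simp

lemma delta3_gt_1: "\<delta>3 > 1"
proof -
  have "sqrt (1 - \<beta>) < 1" "sqrt (1 - \<beta>) > 0" using alpha_pos alpha_beta beta_less by auto
  thus ?thesis by (simp add: delta3_def)
qed

lemma delta1: "0 < \<delta>1" "\<delta>1 \<le> 1/6" "1 + \<delta>1 \<le> sqrt (2 * (1 - \<alpha>))" "1 + \<delta>1 \<le> \<delta>3"
proof -
  have "\<delta>1 = min (1/6) (min (sqrt (2 * (1 - \<alpha>)) - 1) (\<delta>3 - 1))" by (simp add: delta1_def delta3_def)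
  thus "0 < \<delta>1" "\<delta>1 \<le> 1/6" "1 + \<delta>1 \<le> sqrt (2 * (1 - \<alpha>))" "1 + \<delta>1 \<le> \<delta>3"
    using sqrt_armijo delta3_gt_1 by (auto simp: min_def)
qed

lemma delta2: "7/8 \<le> \<delta>2" "\<delta>2 < 1" "1 / sqrt (2 * (1 - \<alpha>)) \<le> \<delta>2"
  using sqrt_armijo by (auto simp: delta2_def)

lemma delta2_gap: "7/12 \<le> 2 * \<delta>2 - 1 - \<delta>1" using delta1 delta2 by simp

lemma delta6_pos: "0 < \<delta>6"
proof -
  have "2 * \<alpha> * (1 - \<beta>) < 1 * 1" using alpha_pos alpha_beta beta_less alpha_half by (intro mult_strict_mono) auto
  moreover have "0 < 2 * \<alpha> * (1 - \<beta>)" using alpha_pos beta_less by simp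
  ultimately show ?thesis by (simp add: delta6_def)
qed

text \<open>
Each of the three terms in the minimum that defines \<open>\<delta>\<^sub>1\<close> controls one of the two values of \<open>\<omega>\<close>: the
first two control \<open>\<omega>(\<delta>\<^sub>2 - 1)\<close>, because \<open>\<delta>\<^sub>2\<close> is the maximum of \<open>7 / 8\<close> and the inverse of the square
root, and the third controls \<open>\<omega>(\<delta>\<^sub>3 - 1)\<close>. As \<open>\<omega>\<close> is quadratic near 0 and \<open>\<delta>\<^sub>1 \<le> 1 / 6\<close>, a linear bound
in \<open>\<delta>\<^sub>1\<close> results.
\<close>

lemma delta4_denominator:
  "0 < min (omega (\<delta>2 - 1)) (omega (\<delta>3 - 1))" "min (omega (\<delta>2 - 1)) (omega (\<delta>3 - 1)) \<le> \<delta>1 / 4"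
proof -
  have pos: "0 < omega (\<rho> - 1)" if "\<rho> > 0" "\<rho> \<noteq> 1" for \<rho>
  proof -
    have "0 < (\<rho> - 1)\<^sup>2" using that by simp
    also note square_le_omega[OF that(1)]
    finally show ?thesis using that by (simp add: zero_less_mult_iff)
  qed
  show "0 < min (omega (\<delta>2 - 1)) (omega (\<delta>3 - 1))" using pos[of \<delta>2] pos[of \<delta>3] delta2 delta3_gt_1 by simp
  have eq: "\<delta>1 = min (1/6) (min (sqrt (2 * (1 - \<alpha>)) - 1) (\<delta>3 - 1))" by (simp add: delta1_def delta3_def)
  have small: "e\<^sup>2 \<le> e / 4" if "0 \<le> e" "e \<le> 1/6" for e :: real
    using mult_left_mono[of e "1/4" e] that by (simp add: power2_eq_square)
  consider "\<delta>1 = 1/6" | "\<delta>1 = sqrt (2 * (1 - \<alpha>)) - 1" | "\<delta>1 = \<delta>3 - 1" using eq by (auto simp: min_def split: if_splits)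
  thus "min (omega (\<delta>2 - 1)) (omega (\<delta>3 - 1)) \<le> \<delta>1 / 4"
  proof cases
    case 1
    have "omega (\<delta>2 - 1) \<le> omega (-1/8)" using delta2 by (intro omega_antimono) auto
    also have "\<dots> \<le> (-1/8)\<^sup>2 / (1 + (-1/8))" by (rule omega_upper_bound) simp
    also have "\<dots> \<le> \<delta>1 / 4" using 1 by (simp add: power2_eq_square)
    finally show ?thesis by simp
  next
    case 2
    define e where "e = sqrt (2 * (1 - \<alpha>)) - 1"
    have e: "0 < e" "e \<le> 1/6" "\<delta>1 = e" using delta1 2 by (auto simp: e_def)
    have "1 / (1 + e) \<le> \<delta>2" using delta2(3) by (simp add: e_def)
    hence "omega (\<delta>2 - 1) \<le> omega (1 / (1 + e) - 1)" using e delta2 by (intro omega_antimono) auto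
    also have "\<dots> \<le> (1 / (1 + e) - 1)\<^sup>2 / (1 + (1 / (1 + e) - 1))" using e by (intro omega_upper_bound) simp
    also have "\<dots> = e\<^sup>2 / (1 + e)"
    proof -
      have 1: "1 / (1 + e) - 1 = - e / (1 + e)" and 2: "1 + - e / (1 + e) = 1 / (1 + e)"
        using e by (simp_all add: field_simps)
      show ?thesis unfolding 1 2 using e by (simp add: power2_eq_square)
    qed
    also have "\<dots> \<le> e\<^sup>2" using e mult_left_mono[of 1 "1 + e" "e\<^sup>2"] by (simp add: field_simps)
    also have "\<dots> \<le> e / 4" using small e by simp
    finally show ?thesis using e by simp
  next
    case 3
    have "omega (\<delta>3 - 1) \<le> (\<delta>3 - 1)\<^sup>2 / (1 + (\<delta>3 - 1))" using delta3_gt_1 by (intro omega_upper_bound) simp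
    also have "\<dots> \<le> (\<delta>3 - 1)\<^sup>2" using delta3_gt_1 mult_left_mono[of 1 \<delta>3 "(\<delta>3 - 1)\<^sup>2"] by (simp add: field_simps)
    also have "\<dots> \<le> \<delta>1 / 4" using small[of "\<delta>3 - 1"] delta1 3 by simp
    finally show ?thesis by simp
  qed
qed

lemma delta4_ge: "4 / \<delta>1 \<le> \<delta>4"
proof -
  have "1 / (\<delta>1 / 4) \<le> \<delta>4" unfolding delta4_def using delta4_denominator by (intro divide_left_mono) auto
  thus ?thesis by simp
qed

lemma delta4_pos: "0 < \<delta>4" unfolding delta4_def using delta4_denominator by simp

lemma delta5_pos: "0 < \<delta>5"
  unfolding delta5_def using delta2_gap delta2 delta3_gt_1 by (intro divide_pos_pos) auto

lemma omega_outside_interval: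
  assumes "\<rho> > 0" and "\<not> (\<delta>2 \<le> \<rho> \<and> \<rho> \<le> \<delta>3)"
  shows "1 \<le> \<delta>4 * omega (\<rho> - 1)"
proof -
  have "min (omega (\<delta>2 - 1)) (omega (\<delta>3 - 1)) \<le> omega (\<rho> - 1)"
    using assms delta2 delta3_gt_1 omega_antimono[of "\<rho> - 1" "\<delta>2 - 1"] omega_mono[of "\<delta>3 - 1" "\<rho> - 1"]
    by (cases "\<rho> < \<delta>2") auto
  thus ?thesis unfolding delta4_def using delta4_denominator by simp
qed

lemma square_le_omega_inside_interval:
  assumes "\<delta>2 \<le> \<rho>" and "\<rho> \<le> \<delta>3"
  shows "(\<rho> - 1)\<^sup>2 / (2 * \<delta>2 - 1 - \<delta>1) \<le> \<delta>5 * omega (\<rho> - 1)"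
proof -
  have r: "\<rho> > 0" using assms delta2 by linarith
  have "2 + 2 * \<rho> \<le> max (2 + 2 / \<delta>2) (4 * \<delta>3)"
  proof (cases "\<rho> \<le> 1")
    case True
    have "1 \<le> 1 / \<delta>2" using delta2 by simp
    hence "2 + 2 * \<rho> \<le> 2 + 2 / \<delta>2" using True by simp
    thus ?thesis by simp
  next
    case False
    thus ?thesis using assms by simp
  qed
  hence "(\<rho> - 1)\<^sup>2 \<le> max (2 + 2 / \<delta>2) (4 * \<delta>3) * omega (\<rho> - 1)"
    using square_le_omega[OF r] mult_right_mono[OF _ omega_nonneg[of "\<rho> - 1"]] r by fastforce
  from divide_right_mono[OF this, of "2 * \<delta>2 - 1 - \<delta>1"] show ?thesis
    using delta2_gap by (simp add: delta5_def)
qed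

lemma delta7_ge_1: "1 \<le> \<delta>7"
  using delta4_pos delta5_pos delta6_pos by (simp add: delta7_def)

lemma delta8_ge: "1 + 2 * \<delta>7 + 1 / (2 * \<delta>2 - 1 - \<delta>1) \<le> \<delta>8"
proof -
  have "ln \<delta>2 \<le> 0" using delta2 by simp
  hence "1 / (2 * \<delta>2 - 1 - \<delta>1) \<le> (2 * \<delta>2 - \<delta>1 - ln \<delta>2) / (2 * \<delta>2 - 1 - \<delta>1)"
    using delta1 delta2(1) delta2_gap by (intro divide_right_mono) linarith+
  thus ?thesis by (simp add: delta8_def)
qed

lemma delta8_pos: "0 < \<delta>8"
proof -
  have "0 < 1 / (2 * \<delta>2 - 1 - \<delta>1)" using delta2_gap by simp
  thus ?thesis using delta8_ge delta7_ge_1 by linarith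
qed

text \<open>
The number of iterations in the initial phase is an integer, and rounding it up costs at most one
extra \<open>\<delta>\<^sub>6\<close>. That term can be charged to the summand with \<open>\<delta>\<^sub>8\<close>, because \<open>\<delta>\<^sub>8 \<ge> 2 \<delta>\<^sub>4 \<delta>\<^sub>6\<close> and
\<open>\<delta>\<^sub>4 \<ge> 4 / \<delta>\<^sub>1\<close>.
\<close>

lemma delta8_absorbs_delta6:
  assumes "\<delta>1 < C" shows "\<delta>6 \<le> \<delta>8 * C / 8"
proof -
  have "0 < 1 / (2 * \<delta>2 - 1 - \<delta>1)" using delta2_gap by simp
  moreover have "\<delta>7 = 1 + \<delta>4 * \<delta>6 + \<delta>5" by (simp add: delta7_def)
  ultimately have "2 * (\<delta>4 * \<delta>6) \<le> \<delta>8" using delta8_ge delta5_pos by linarith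
  moreover have "4 / \<delta>1 * \<delta>6 \<le> \<delta>4 * \<delta>6" using delta4_ge delta6_pos by (intro mult_right_mono) auto
  ultimately have "8 * \<delta>6 / \<delta>1 \<le> \<delta>8" by simp
  hence "8 * \<delta>6 \<le> \<delta>8 * \<delta>1" using delta1 by (simp add: field_simps)
  also have "\<dots> \<le> \<delta>8 * C" using delta8_pos assms by simp
  finally show ?thesis by simp
qed

end

section \<open>Means and geometric sums\<close>

text \<open>
The inequality of arithmetic and geometric means, from \<open>u \<le> exp (u - 1)\<close> at \<open>u = a\<^sub>i / m\<close> for the
mean \<open>m\<close>: the exponents add up to 0.
\<close>

lemma prod_le_power_of_mean:
  fixes a :: "nat \<Rightarrow> real"
  assumes a: "\<And>i. i < t \<Longrightarrow> 0 < a i" and t: "t \<ge> 1"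
  shows "(\<Prod>i<t. a i) \<le> ((\<Sum>i<t. a i) / real t) ^ t"
proof -
  define m where "m = (\<Sum>i<t. a i) / real t"
  have "0 < (\<Sum>i<t. a i)" using a t by (intro sum_pos) (auto simp: lessThan_empty_iff)
  hence m: "m > 0" using t by (simp add: m_def)
  have "(\<Prod>i<t. a i / m) \<le> (\<Prod>i<t. exp (a i / m - 1))"
  proof (rule prod_mono)
    fix i assume "i \<in> {..<t}"
    thus "0 \<le> a i / m \<and> a i / m \<le> exp (a i / m - 1)"
      using a[of i] m exp_ge_add_one_self[of "a i / m - 1"] by simp
  qed
  also have "\<dots> = exp (\<Sum>i<t. a i / m - 1)" by (simp add: exp_sum)
  also have "(\<Sum>i<t. a i / m - 1) = 0"
    using \<open>0 < (\<Sum>i<t. a i)\<close> t by (simp add: sum_subtractf sum_divide_distrib[symmetric]) (simp add: m_def)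
  finally have "(\<Prod>i<t. a i) / m ^ t \<le> 1" by (simp add: prod_dividef)
  thus ?thesis using m by (simp add: m_def)
qed

text \<open>
Jensen's inequality for the exponential function, from its tangent at the mean.
\<close>

lemma sum_exp_ge_exp_mean:
  fixes l :: "nat \<Rightarrow> real"
  assumes t: "t \<ge> 1"
  shows "real t * exp (- ((\<Sum>i<t. l i) / real t)) \<le> (\<Sum>i<t. exp (- l i))"
proof -
  define m where "m = (\<Sum>i<t. l i) / real t"
  have "(\<Sum>i<t. exp (- m) * (1 + (m - l i))) \<le> (\<Sum>i<t. exp (- l i))"
  proof (rule sum_mono)
    fix i
    have "exp (- m) * (1 + (m - l i)) \<le> exp (- m) * exp (m - l i)"
      by (intro mult_left_mono exp_ge_add_one_self) simp
    thus "exp (- m) * (1 + (m - l i)) \<le> exp (- l i)" by (simp add: exp_add[symmetric])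
  qed
  also have "(\<Sum>i<t. exp (- m) * (1 + (m - l i))) = exp (- m) * (real t + (real t * m - (\<Sum>i<t. l i)))"
    by (simp add: sum_distrib_left[symmetric] sum.distrib sum_subtractf)
  also have "\<dots> = real t * exp (- m)" using t by (simp add: m_def)
  finally show ?thesis by (simp add: m_def)
qed

text \<open>
For \<open>k > 0\<close> the geometric terms are at most the integral of \<open>exp (- a u)\<close> over the unit interval
before \<open>k\<close>. They are bounded in this way from the first \<open>k > 0\<close> with \<open>k \<ge> D\<close> on; the indices before
that number at most \<open>D + 1\<close> and contribute at most 1 each.
\<close>

lemma sum_delayed_geometric:
  fixes D a :: real
  assumes D: "D \<ge> 0" and a: "a > 0"
  shows "(\<Sum>k<t. if real k < D then 1 else exp (- a * real k)) \<le> D + 1 + 1 / a"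
proof -
  define w where "w k = (if real k < D then 1 else exp (- a * real k))" for k
  have w1: "w k \<le> 1" for k using a by (simp add: w_def)
  have geo: "exp (- a * real (Suc k)) \<le> (exp (- a * real k) - exp (- a * real (Suc k))) / a" for k
  proof -
    have "exp (- a * real (Suc k)) * (1 + a) \<le> exp (- a * real (Suc k)) * exp a"
      by (intro mult_left_mono exp_ge_add_one_self) simp
    also have "\<dots> = exp (- a * real k)" by (simp add: exp_add[symmetric] algebra_simps)
    finally show ?thesis using a by (simp add: field_simps)
  qed
  have "(\<Sum>k<Suc n. w k) \<le> D + 1 + (1 - exp (- a * real n)) / a" for n
  proof (induction n)
    case 0
    show ?case using D w1[of 0] by simp
  next
    case (Suc n)
    show ?case
    proof (cases "real (Suc n) < D")
      case True
      have "(\<Sum>k<Suc (Suc n). w k) \<le> (\<Sum>k<Suc (Suc n). 1)" by (intro sum_mono w1)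
      also have "\<dots> \<le> D + 1" using True by simp
      also have "\<dots> \<le> D + 1 + (1 - exp (- a * real (Suc n))) / a" using a by simp
      finally show ?thesis .
    next
      case False
      hence "w (Suc n) = exp (- a * real (Suc n))" by (simp add: w_def)
      hence "(\<Sum>k<Suc (Suc n). w k) \<le> D + 1 + (1 - exp (- a * real n)) / a + (exp (- a * real n) - exp (- a * real (Suc n))) / a"
        using Suc geo[of n] by simp
      also have "\<dots> = D + 1 + (1 - exp (- a * real (Suc n))) / a" by (simp add: diff_divide_distrib)
      finally show ?thesis .
    qed
  qed
  moreover have "(1 - exp (- a * real n)) / a \<le> 1 / a" for n using a by (intro divide_right_mono) auto
  ultimately have "(\<Sum>k<Suc n. w k) \<le> D + 1 + 1 / a" for n by (meson add_left_mono order_trans)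
  moreover have "0 \<le> D + 1 + 1 / a" using D a by simp
  ultimately have "(\<Sum>k<t. w k) \<le> D + 1 + 1 / a" by (cases t) auto
  thus ?thesis by (simp add: w_def)
qed

lemma card_nat_less_real:
  assumes "D \<ge> 0" and "\<And>k. k \<in> S \<Longrightarrow> real k < D"
  shows "real (card S) \<le> D + 1"
proof -
  have "S \<subseteq> {..<nat \<lceil>D\<rceil>}"
  proof
    fix k assume "k \<in> S"
    hence "real k < D" by (rule assms(2))
    thus "k \<in> {..<nat \<lceil>D\<rceil>}" by simp linarith
  qed
  hence "card S \<le> nat \<lceil>D\<rceil>" using card_mono[of "{..<nat \<lceil>D\<rceil>}" S] by simp
  thus ?thesis using assms(1) by linarith
qed

section \<open>Steps inside a sublevel set\<close>

text \<open>
The Hessian is controlled on the sublevel set only, and \<open>x + d\<close> is not known to lie in it. If it did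
not, the ray from \<open>x\<close> along \<open>d\<close> would return to the level of \<open>x\<close> at some \<open>\<tau> \<le> 1\<close>. The segment up to
there lies in the sublevel set by convexity, but the quadratic upper model is still below the level of
\<open>x\<close> at \<open>\<tau>\<close>.
\<close>

lemma (in smooth_strongly_convex) full_step_decreases:
  assumes desc: "d \<bullet> g x < 0"
    and large: "(1 + C_const M \<mu> f xs x) * (d \<bullet> (H xs *v d)) < - 2 * (d \<bullet> g x)"
  shows "f (x + d) \<le> f x"
proof (rule ccontr)
  assume "\<not> f (x + d) \<le> f x"
  hence up: "f x < f (x + d)" by simp
  define C S where "C = C_const M \<mu> f xs x" and "S = d \<bullet> (H xs *v d)"
  have CS: "C \<ge> 0" "S \<ge> 0"
    using C_const_nonneg spd_nonneg[OF hessian_spd] by (simp_all add: C_def S_def)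
  have "d \<bullet> g (x + 0 *\<^sub>R d) < 0" using desc by simp
  from DERIV_neg_dec_right[OF f_line_derivative this]
  \<comment> \<open>The direction is one of descent, so \<open>f\<close> falls below its initial level before it rises above it.\<close>
  obtain e where e: "e > 0" "\<And>h. 0 < h \<Longrightarrow> h < e \<Longrightarrow> f (x + h *\<^sub>R d) < f x" by auto
  define h where "h = min (e / 2) (1 / 2)"
  have h: "0 < h" "h < 1" "f (x + h *\<^sub>R d) < f x" using e by (auto simp: h_def min_def)
  have "\<exists>\<tau>\<ge>h. \<tau> \<le> 1 \<and> f (x + \<tau> *\<^sub>R d) = f x"
  proof (rule IVT)
    show "\<forall>\<tau>. h \<le> \<tau> \<and> \<tau> \<le> 1 \<longrightarrow> isCont (\<lambda>\<tau>. f (x + \<tau> *\<^sub>R d)) \<tau>"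
      using f_line_derivative DERIV_isCont by blast
  qed (use h up in auto)
  then obtain \<tau> where \<tau>: "h \<le> \<tau>" "\<tau> \<le> 1" "f (x + \<tau> *\<^sub>R d) = f x" by blast
  let ?v = "\<tau> *\<^sub>R d"
  have "f (x + ?v) - f x - ?v \<bullet> g x \<le> (1 + C) * (?v \<bullet> (H xs *v ?v)) / 2"
  proof (rule taylor_upper)
    fix \<sigma> :: real assume "0 \<le> \<sigma>" "\<sigma> \<le> 1"
    hence "f (x + \<sigma> *\<^sub>R ?v) \<le> f x" using segment_below[of x "f x" "x + ?v" \<sigma>] \<tau> by simp
    thus "?v \<bullet> (H (x + \<sigma> *\<^sub>R ?v) *v ?v) \<le> (1 + C) * (?v \<bullet> (H xs *v ?v))"
      unfolding C_def by (rule hessian_comparison)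
  qed
  hence "\<tau> * (- (d \<bullet> g x)) \<le> \<tau> * (\<tau> * ((1 + C) * S) / 2)"
    using \<tau> by (simp add: matrix_vector_mult_scaleR S_def mult_ac)
  hence "- (d \<bullet> g x) \<le> \<tau> * ((1 + C) * S) / 2"
    using \<tau> h mult_le_cancel_left_pos[of \<tau> "- (d \<bullet> g x)" "\<tau> * ((1 + C) * S) / 2"] by linarith
  also have "\<dots> \<le> (1 + C) * S / 2" using \<tau> h CS mult_right_mono[of \<tau> 1 "(1 + C) * S"] by simp
  also have "\<dots> < - (d \<bullet> g x)" using large by (simp add: C_def S_def)
  finally show False by simp
qed

lemma (in smooth_strongly_convex) sublevel_step_bounds:
  assumes "f (x + s) \<le> f x"
  defines "C \<equiv> C_const M \<mu> f xs x" and "S \<equiv> s \<bullet> (H xs *v s)" and "y \<equiv> g (x + s) - g x"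
  shows "f (x + s) - f x - s \<bullet> g x \<le> (1 + C) * S / 2"
    and "S / (1 + C) \<le> s \<bullet> y"
    and "y \<bullet> (matrix_inv (H xs) *v y) \<le> (1 + C) * (s \<bullet> y)"
proof -
  have C: "C \<ge> 0" using C_const_nonneg by (simp add: C_def)
  have seg: "f (x + \<tau> *\<^sub>R s) \<le> f x" if "0 \<le> \<tau>" "\<tau> \<le> 1" for \<tau>
    using segment_below[of x "f x" "x + s" \<tau>] assms(1) that by simp
  show "f (x + s) - f x - s \<bullet> g x \<le> (1 + C) * S / 2"
    unfolding C_def S_def by (rule taylor_upper) (use seg hessian_comparison in blast)
  show "S / (1 + C) \<le> s \<bullet> y"
    unfolding y_def
  proof (rule taylor_lower)
    fix \<tau> :: real assume "0 \<le> \<tau>" "\<tau> \<le> 1"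
    thus "S / (1 + C) \<le> s \<bullet> (H (x + \<tau> *\<^sub>R s) *v s)"
      using hessian_comparison(2)[OF seg, of \<tau> s] C unfolding C_def S_def by (simp add: field_simps)
  qed
  show "y \<bullet> (matrix_inv (H xs) *v y) \<le> (1 + C) * (s \<bullet> y)"
    unfolding y_def
    by (rule weighted_cocoercivity[OF hessian_spd]) (use seg C hessian_comparison(1) in \<open>auto simp: C_def\<close>)
qed

lemma (in smooth_strongly_convex) sublevel_gradient_domination:
  "2 / (1 + C_const M \<mu> f xs x) * (f x - f xs) \<le> g x \<bullet> (matrix_inv (H xs) *v g x)"
proof -
  define C where "C = C_const M \<mu> f xs x"
  have C: "C \<ge> 0" using C_const_nonneg by (simp add: C_def)
  have "2 * (1 / (1 + C)) * (f x - f xs) \<le> g x \<bullet> (matrix_inv (H xs) *v g x)"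
  proof (rule weighted_gradient_domination[OF hessian_spd])
    fix \<tau> :: real and v assume "0 \<le> \<tau>" "\<tau> \<le> 1"
    hence "f (x + \<tau> *\<^sub>R (xs - x)) \<le> f x" using segment_below[of x "f x" xs \<tau>] minimizer by simp
    from hessian_comparison(2)[OF this, of v]
    show "1 / (1 + C) * (v \<bullet> (H xs *v v)) \<le> v \<bullet> (H (x + \<tau> *\<^sub>R (xs - x)) *v v)"
      using C unfolding C_def by (simp add: field_simps)
  qed (use C in simp)
  thus ?thesis by (simp add: C_def)
qed

section \<open>The loss of an iteration\<close>

locale bfgs_armijo_wolfe =
  smooth_strongly_convex f \<mu> L M xs + wolfe_parameters \<alpha> \<beta>
  for f :: "real^'n \<Rightarrow> real" and \<mu> L M xs \<alpha> \<beta> +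
  fixes x :: "nat \<Rightarrow> real^'n" and B :: "nat \<Rightarrow> real^'n^'n" and \<eta> :: "nat \<Rightarrow> real"
  assumes iterates: "bfgs_iterates f x B \<eta>"
    and line_search: "\<And>k. armijo_wolfe f \<alpha> \<beta> (x k) (bfgs_direction f (x k) (B k)) (\<eta> k)"
    and unit_preferred:
      "\<And>k. armijo_wolfe f \<alpha> \<beta> (x k) (bfgs_direction f (x k) (B k)) 1 \<Longrightarrow> \<eta> k = 1"
begin

definition "dir k = bfgs_direction f (x k) (B k)"
definition "step k = x (Suc k) - x k"
definition "grad_diff k = g (x (Suc k)) - g (x k)"
definition "slope k = - (step k \<bullet> g (x k))"
definition "gap k = f (x k) - f xs"
definition "C k = C_const M \<mu> f xs (x k)"

lemma iterate_facts:
  "sym_pos_def (B 0)" "g (x k) \<noteq> 0" "\<eta> k > 0" "step k = \<eta> k *\<^sub>R dir k"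
  "x (Suc k) = x k + \<eta> k *\<^sub>R dir k" "x (Suc k) = x k + step k"
  "B (Suc k) = bfgs_update (B k) (step k) (grad_diff k)"
  using iterates by (auto simp: bfgs_iterates_def step_def grad_diff_def dir_def)

lemma step_if_spd:
  assumes B: "sym_pos_def (B k)"
  shows "B k *v step k = - \<eta> k *\<^sub>R g (x k)" and "slope k > 0" and "step k \<noteq> 0"
    and "step k \<bullet> (B k *v step k) = \<eta> k * slope k"
proof -
  have d: "dir k = - (matrix_inv (B k) *v g (x k))" by (simp add: dir_def bfgs_direction_def)
  have "B k *v dir k = - g (x k)" using spd_inv_cancel(1)[OF B]
    by (simp add: d linear_neg[OF matrix_vector_mul_linear])
  thus Bs: "B k *v step k = - \<eta> k *\<^sub>R g (x k)"
    by (simp add: iterate_facts(4) matrix_vector_mult_scaleR)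
  have "slope k = \<eta> k * (g (x k) \<bullet> (matrix_inv (B k) *v g (x k)))"
    by (simp add: slope_def iterate_facts(4) d inner_commute)
  thus pos: "slope k > 0"
    using spd_pos[OF spd_inverse[OF B] iterate_facts(2)] iterate_facts(3) by simp
  thus "step k \<noteq> 0" by (auto simp: slope_def)
  show "step k \<bullet> (B k *v step k) = \<eta> k * slope k" by (simp add: Bs slope_def)
qed

lemma armijo: "\<alpha> * slope k \<le> gap k - gap (Suc k)"
  using line_search[of k] iterate_facts(3)[of k]
  unfolding armijo_wolfe_def dir_def[symmetric] iterate_facts(5)[symmetric]
  by (simp add: gap_def slope_def iterate_facts(4) inner_commute algebra_simps)

lemma wolfe: "(1 - \<beta>) * slope k \<le> step k \<bullet> grad_diff k"
proof -
  have "\<beta> * (g (x k) \<bullet> dir k) \<le> g (x (Suc k)) \<bullet> dir k"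
    using line_search[of k] unfolding armijo_wolfe_def dir_def[symmetric] iterate_facts(5)[symmetric] by simp
  hence "\<eta> k * (\<beta> * (g (x k) \<bullet> dir k)) \<le> \<eta> k * (g (x (Suc k)) \<bullet> dir k)"
    using iterate_facts(3)[of k] by simp
  thus ?thesis
    by (simp add: slope_def grad_diff_def iterate_facts(4) inner_diff_right inner_commute algebra_simps)
qed

lemma B_spd: "sym_pos_def (B k)"
proof (induction k)
  case 0
  show ?case by (rule iterate_facts(1))
next
  case (Suc k)
  have "0 < (1 - \<beta>) * slope k" using step_if_spd(2)[OF Suc] beta_less by simp
  also note wolfe[of k]
  finally show ?case unfolding iterate_facts(7)
    by (intro spd_bfgs_update[OF Suc step_if_spd(3)[OF Suc]])
qed

lemmas step_facts = step_if_spd[OF B_spd]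

lemma curvature_pos: "step k \<bullet> grad_diff k > 0"
proof -
  have "0 < (1 - \<beta>) * slope k" using step_facts(2) beta_less by simp
  also note wolfe[of k]
  finally show ?thesis .
qed

lemma gap_pos: "gap k > 0"
proof (rule ccontr)
  assume "\<not> gap k > 0"
  hence "\<mu> * (norm (x k - xs))\<^sup>2 \<le> 0" using sublevel_distance[of "x k"] by (simp add: gap_def)
  hence "x k = xs" using mu_pos by (simp add: mult_le_0_iff)
  thus False using gradient_minimizer iterate_facts(2)[of k] by simp
qed

lemma gap_decreases: "gap (Suc k) < gap k"
proof -
  have "0 < \<alpha> * slope k" using step_facts(2) alpha_pos by simp
  thus ?thesis using armijo[of k] by linarith
qed

lemma f_decreases: "f (x k + step k) \<le> f (x k)"
  using gap_decreases[of k] by (simp add: gap_def iterate_facts(6))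

text \<open>
The loss is the negative logarithm of the fraction of the gap that iteration \<open>k\<close> removes; it is small
when nearly all of the gap disappears.
\<close>

definition "loss k = - ln (1 - gap (Suc k) / gap k)"

lemma rate_pos: "0 < 1 - gap (Suc k) / gap k"
  using gap_decreases[of k] gap_pos[of k] by simp

lemma ratio_le_loss: "gap (Suc k) / gap k \<le> loss k"
  using ln_le_minus_one[OF rate_pos, of k] by (simp add: loss_def)

lemma gap_ratio_prod: "gap t / gap 0 = (\<Prod>k<t. gap (Suc k) / gap k)"
proof (induction t)
  case (Suc t)
  have "gap (Suc t) / gap 0 = gap t / gap 0 * (gap (Suc t) / gap t)" using gap_pos[of t] by simp
  thus ?case by (simp only: Suc prod.lessThan_Suc)
qed (use gap_pos[of 0] in simp)

text \<open>
The factorisation of the removed fraction of the gap into decrease, curvature, gradient domination and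
angle. Because \<open>B s = - \<eta> g\<close>, the angle term of the potential does not depend on the step size. The
number \<open>q\<close> bounds the product of the decrease and curvature factors.
\<close>

lemma loss_le_potential:
  assumes P: "sym_pos_def P" and c: "c > 0"
    and dom: "2 * c * gap k \<le> g (x k) \<bullet> (matrix_inv P *v g (x k))"
    and q: "q > 0" "q \<le> (gap k - gap (Suc k)) / slope k * ((step k \<bullet> grad_diff k) / slope k)"
  shows "loss k \<le> - ln (2 * c * q) + bfgs_potential P (B k) - bfgs_potential P (B (Suc k))
    + (grad_diff k \<bullet> (matrix_inv P *v grad_diff k)) / (step k \<bullet> grad_diff k) - 1"
proof -
  define G \<sigma> \<gamma> where "G = g (x k) \<bullet> (matrix_inv P *v g (x k))" and "\<sigma> = step k \<bullet> grad_diff k" and "\<gamma> = slope k"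
  have \<sigma>: "\<sigma> > 0" using curvature_pos by (simp add: \<sigma>_def)
  have \<gamma>: "\<gamma> > 0" using step_facts(2) by (simp add: \<gamma>_def)
  have \<eta>: "\<eta> k > 0" by (rule iterate_facts(3))
  have G: "G > 0" using spd_pos[OF spd_inverse[OF P] iterate_facts(2)] by (simp add: G_def)
  have F: "gap k > 0" "gap k - gap (Suc k) > 0" using gap_pos gap_decreases by simp_all
  have e: "(B k *v step k) \<bullet> (matrix_inv P *v (B k *v step k)) = (\<eta> k)\<^sup>2 * G"
  proof -
    have "matrix_inv P *v (- \<eta> k *\<^sub>R g (x k)) = - \<eta> k *\<^sub>R (matrix_inv P *v g (x k))"
      by (rule matrix_vector_mult_scaleR)
    thus ?thesis by (simp add: step_facts(1) G_def power2_eq_square)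
  qed
  have b: "step k \<bullet> (B k *v step k) = \<eta> k * \<gamma>" using step_facts(4) by (simp add: \<gamma>_def)
  have angle: "(\<eta> k * \<gamma>)\<^sup>2 / ((\<eta> k)\<^sup>2 * G * \<sigma>) = \<gamma>\<^sup>2 / (G * \<sigma>)"
    using \<eta> by (simp add: power_mult_distrib)
  have "- ln (\<gamma>\<^sup>2 / (G * \<sigma>)) \<le> bfgs_potential P (B k) - bfgs_potential P (B (Suc k))
      + (grad_diff k \<bullet> (matrix_inv P *v grad_diff k)) / (step k \<bullet> grad_diff k) - 1"
    using potential_decrease_angle[OF P B_spd step_facts(3) curvature_pos, of k k]
    unfolding e b \<sigma>_def[symmetric] angle iterate_facts(7) .
  moreover have "loss k \<le> - ln (2 * c * q) - ln (\<gamma>\<^sup>2 / (G * \<sigma>))"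
  proof -
    have "2 * c * q * gap k \<le> G * ((gap k - gap (Suc k)) / \<gamma> * (\<sigma> / \<gamma>))"
    proof -
      have "(2 * c * gap k) * q \<le> G * ((gap k - gap (Suc k)) / \<gamma> * (\<sigma> / \<gamma>))"
        using dom q c F G by (intro mult_mono) (auto simp: G_def \<sigma>_def \<gamma>_def)
      thus ?thesis by (simp add: mult_ac)
    qed
    hence "2 * c * q * gap k * (\<gamma>\<^sup>2 / (G * \<sigma>)) \<le> G * ((gap k - gap (Suc k)) / \<gamma> * (\<sigma> / \<gamma>)) * (\<gamma>\<^sup>2 / (G * \<sigma>))"
      using G \<sigma> by (intro mult_right_mono) auto
    also have "\<dots> = gap k - gap (Suc k)" using G \<sigma> \<gamma> by (simp add: power2_eq_square)
    finally have "2 * c * q * (\<gamma>\<^sup>2 / (G * \<sigma>)) \<le> (gap k - gap (Suc k)) / gap k"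
      using F by (simp add: pos_le_divide_eq mult_ac)
    also have "\<dots> = 1 - gap (Suc k) / gap k" using F by (simp add: diff_divide_distrib)
    finally have "ln (2 * c * q * (\<gamma>\<^sup>2 / (G * \<sigma>))) \<le> ln (1 - gap (Suc k) / gap k)"
      using c q G \<sigma> \<gamma> by (intro ln_mono mult_pos_pos divide_pos_pos) auto
    moreover have "ln (2 * c * q * (\<gamma>\<^sup>2 / (G * \<sigma>))) = ln (2 * c * q) + ln (\<gamma>\<^sup>2 / (G * \<sigma>))"
      using c q G \<sigma> \<gamma> by (intro ln_mult_pos mult_pos_pos divide_pos_pos) auto
    ultimately show ?thesis by (simp add: loss_def)
  qed
  ultimately show ?thesis by simp
qed

lemma armijo_wolfe_product:
  "\<alpha> * (1 - \<beta>) \<le> (gap k - gap (Suc k)) / slope k * ((step k \<bullet> grad_diff k) / slope k)"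
proof -
  have "\<alpha> \<le> (gap k - gap (Suc k)) / slope k" "1 - \<beta> \<le> (step k \<bullet> grad_diff k) / slope k"
    using armijo[of k] wolfe[of k] step_facts(2)[of k] by (simp_all add: pos_le_divide_eq)
  thus ?thesis using alpha_pos beta_less by (intro mult_mono) auto
qed

lemma C_facts: "C k \<ge> 0" "C k \<le> C 0" "C k = C 0 * sqrt (gap k / gap 0)"
proof -
  show "C k \<ge> 0" using C_const_nonneg by (simp add: C_def)
  have "gap k \<le> gap 0" using lift_Suc_antimono_le[of gap 0 k] gap_decreases less_imp_le by blast
  thus "C k \<le> C 0" using M_pos mu_pos by (simp add: C_def C_const_def gap_def divide_right_mono)
  show "C k = C 0 * sqrt (gap k / gap 0)"
  proof -
    have "C j = M / \<mu> powr (3/2) * (sqrt 2 * sqrt (gap j))" for j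
      by (simp only: C_def C_const_def gap_def real_sqrt_mult)
    thus ?thesis using gap_pos[of 0] by (simp add: real_sqrt_divide)
  qed
qed

section \<open>Losses in the geometry of the optimal Hessian\<close>

text \<open>
The curvature along \<open>d\<close> deviates from that of the optimal Hessian by a factor of at most \<open>1 + c\<close>. Both
\<open>1 + c\<close> and \<open>S / G\<close> are at most \<open>sqrt (2 (1 - \<alpha>))\<close>, so their product is at most \<open>2 (1 - \<alpha>)\<close> and the
Armijo condition follows; both \<open>1 + c\<close> and \<open>G / S\<close> are at most \<open>1 / sqrt (1 - \<beta>)\<close>, which gives the
Wolfe condition.
\<close>

lemma full_step_accepted:
  fixes z d :: "real^'n"
  defines "S \<equiv> d \<bullet> (H xs *v d)" and "G \<equiv> - (d \<bullet> g z)" and "c \<equiv> C_const M \<mu> f xs z"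
  assumes G: "0 < G" and small: "c \<le> \<delta>1" and lo: "\<delta>2 * S \<le> G" and hi: "G \<le> \<delta>3 * S"
  shows "armijo_wolfe f \<alpha> \<beta> z d 1"
proof -
  have c: "0 \<le> c" using C_const_nonneg by (simp add: c_def)
  have "d \<noteq> 0" using G by (auto simp: G_def)
  hence S: "0 < S" using spd_pos[OF hessian_spd] by (simp add: S_def)
  have "(1 + c) * S \<le> 7/6 * S" using small delta1 S by (intro mult_right_mono) auto
  moreover have "7/8 * S \<le> \<delta>2 * S" using delta2 S by (intro mult_right_mono) auto
  ultimately have "(1 + c) * S < 2 * G" using lo S by linarith
  hence dec: "f (z + d) \<le> f z"
    using G by (intro full_step_decreases) (simp_all add: G_def S_def c_def)
  note bounds = sublevel_step_bounds[OF dec, folded c_def S_def]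
  define w where "w = sqrt (2 * (1 - \<alpha>))"
  have w: "1 < w" "w * w = 2 * (1 - \<alpha>)" using sqrt_armijo alpha_half by (simp_all add: w_def)
  have "S * (1 / w) \<le> S * \<delta>2" using delta2(3) S by (intro mult_left_mono) (auto simp: w_def)
  hence "S / w \<le> G" using lo by (simp add: mult.commute)
  hence "S \<le> w * G" using w by (simp add: pos_divide_le_eq mult.commute)
  hence "(1 + c) * S \<le> w * (w * G)" using small delta1 c S w by (intro mult_mono) (auto simp: w_def)
  also have "\<dots> = 2 * (1 - \<alpha>) * G" using w(2) by (metis mult.assoc)
  finally have armijo: "f (z + d) \<le> f z - \<alpha> * G" using bounds(1) by (simp add: G_def algebra_simps)
  have d3: "\<delta>3 * \<delta>3 = 1 / (1 - \<beta>)" using beta_less by (simp add: delta3_def)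
  have "(1 - \<beta>) * G \<le> (1 - \<beta>) * (\<delta>3 * S)" using hi beta_less by (intro mult_left_mono) auto
  also have "\<dots> = (1 - \<beta>) * (\<delta>3 * \<delta>3) * S / \<delta>3" using delta3_gt_1 by simp
  also have "\<dots> = S / \<delta>3" using d3 beta_less by simp
  also have "\<dots> \<le> S / (1 + c)" using small delta1 c S by (intro divide_left_mono) auto
  also note bounds(2)
  finally have "\<beta> * (g z \<bullet> d) \<le> g (z + d) \<bullet> d" by (simp add: G_def inner_diff_right inner_commute algebra_simps)
  thus ?thesis using armijo by (simp add: armijo_wolfe_def G_def inner_commute)
qed

abbreviation "\<Psi> k \<equiv> bfgs_potential (H xs) (B k)"
text \<open>
\<open>\<rho>\<close> compares the curvature along the step that \<open>B\<close> predicts with that of the optimal Hessian. It does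
not depend on the length of the step.
\<close>

definition "\<rho> k = (step k \<bullet> (B k *v step k)) / (step k \<bullet> (H xs *v step k))"

lemma weighted_step_pos: "0 < step k \<bullet> (H xs *v step k)"
  using spd_pos[OF hessian_spd step_facts(3)] .

lemma rho_pos: "0 < \<rho> k"
  using weighted_step_pos step_facts(2) iterate_facts(3) by (simp add: \<rho>_def step_facts(4))

lemma unit_step_if_rho_near_1:
  assumes "C k \<le> \<delta>1" "\<delta>2 \<le> \<rho> k" "\<rho> k \<le> \<delta>3"
  shows "\<eta> k = 1"
proof (rule unit_preferred, rule full_step_accepted)
  have \<eta>: "\<eta> k > 0" by (rule iterate_facts(3))
  have s: "step k = \<eta> k *\<^sub>R dir k" by (rule iterate_facts(4))
  let ?S = "dir k \<bullet> (H xs *v dir k)" and ?G = "- (dir k \<bullet> g (x k))"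
  have SS: "step k \<bullet> (H xs *v step k) = (\<eta> k)\<^sup>2 * ?S"
    by (simp add: s matrix_vector_mult_scaleR power2_eq_square)
  hence S: "0 < ?S" using weighted_step_pos[of k] by (simp add: zero_less_mult_iff)
  have slope: "slope k = \<eta> k * ?G" by (simp add: slope_def s)
  have "\<rho> k = ?G / ?S" unfolding \<rho>_def step_facts(4) SS slope using \<eta> by (simp add: power2_eq_square)
  thus "\<delta>2 * (bfgs_direction f (x k) (B k) \<bullet> (H xs *v bfgs_direction f (x k) (B k))) \<le> - (bfgs_direction f (x k) (B k) \<bullet> g (x k))"
    and "- (bfgs_direction f (x k) (B k) \<bullet> g (x k)) \<le> \<delta>3 * (bfgs_direction f (x k) (B k) \<bullet> (H xs *v bfgs_direction f (x k) (B k)))"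
    using assms S pos_le_divide_eq[OF S, of "\<delta>2" ?G] pos_divide_le_eq[OF S, of ?G "\<delta>3"]
    unfolding dir_def[symmetric] by simp_all
  show "0 < - (bfgs_direction f (x k) (B k) \<bullet> g (x k))"
    using step_facts(2)[of k] unfolding slope dir_def[symmetric] by (rule zero_less_mult_pos[OF _ \<eta>])
  show "C_const M \<mu> f xs (x k) \<le> \<delta>1" using assms by (simp add: C_def)
qed

lemma omega_rho_le: "omega (\<rho> k - 1) \<le> \<Psi> k - \<Psi> (Suc k) + 2 * C k"
proof -
  define \<sigma> S where "\<sigma> = step k \<bullet> grad_diff k" and "S = step k \<bullet> (H xs *v step k)"
  have pos: "\<sigma> > 0" "S > 0" "C k \<ge> 0" using curvature_pos weighted_step_pos C_facts(1) by (simp_all add: \<sigma>_def S_def)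
  note bounds = sublevel_step_bounds[OF f_decreases[of k], folded C_def iterate_facts(6), folded grad_diff_def, folded \<sigma>_def S_def]
  have "1 / (1 + C k) \<le> \<sigma> / S" using bounds(2) pos by (simp add: field_simps)
  hence "ln (1 / (1 + C k)) \<le> ln (\<sigma> / S)" using pos by (intro ln_mono) auto
  hence "- ln (\<sigma> / S) \<le> C k" using pos ln_add_one_self_le_self[of "C k"] by (simp add: ln_div)
  moreover have "(grad_diff k \<bullet> (matrix_inv (H xs) *v grad_diff k)) / \<sigma> \<le> 1 + C k"
    using bounds(3) pos by (simp add: pos_divide_le_eq)
  moreover have "omega (\<rho> k - 1) \<le> \<Psi> k - \<Psi> (Suc k) + (grad_diff k \<bullet> (matrix_inv (H xs) *v grad_diff k)) / \<sigma> - 1 - ln (\<sigma> / S)"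
    using potential_decrease_omega[OF hessian_spd[of xs] B_spd[of k] step_facts(3)[of k] curvature_pos[of k]]
    unfolding \<rho>_def iterate_facts(7) \<sigma>_def S_def .
  ultimately show ?thesis by linarith
qed

lemma loss_le_weighted:
  assumes q: "q > 0" "q \<le> (gap k - gap (Suc k)) / slope k * ((step k \<bullet> grad_diff k) / slope k)"
  shows "loss k \<le> - ln (2 * q) + 2 * C k + \<Psi> k - \<Psi> (Suc k)"
proof -
  have C: "C k \<ge> 0" by (rule C_facts(1))
  note bounds = sublevel_step_bounds[OF f_decreases[of k], folded C_def iterate_facts(6), folded grad_diff_def]
  have "loss k \<le> - ln (2 * (1 / (1 + C k)) * q) + \<Psi> k - \<Psi> (Suc k)
      + (grad_diff k \<bullet> (matrix_inv (H xs) *v grad_diff k)) / (step k \<bullet> grad_diff k) - 1"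
    using q C sublevel_gradient_domination[of "x k", folded C_def gap_def]
    by (intro loss_le_potential[OF hessian_spd]) auto
  moreover have "(grad_diff k \<bullet> (matrix_inv (H xs) *v grad_diff k)) / (step k \<bullet> grad_diff k) \<le> 1 + C k"
    using bounds(3) curvature_pos[of k] by (simp add: pos_divide_le_eq)
  moreover have "- ln (2 * (1 / (1 + C k)) * q) = - ln (2 * q) + ln (1 + C k)"
    using q C ln_div[of "2 * q" "1 + C k"] by simp
  moreover have "ln (1 + C k) \<le> C k" using C by (rule ln_add_one_self_le_self)
  ultimately show ?thesis by linarith
qed

lemma loss_le_generic: "loss k \<le> \<delta>6 + 2 * C k + \<Psi> k - \<Psi> (Suc k)"
proof -
  have "\<alpha> * (1 - \<beta>) > 0" using alpha_pos beta_less by simp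
  moreover have "- ln (2 * (\<alpha> * (1 - \<beta>))) = \<delta>6" using alpha_pos beta_less by (simp add: delta6_def ln_div mult.assoc)
  ultimately show ?thesis using loss_le_weighted[OF _ armijo_wolfe_product] by metis
qed

text \<open>
For a unit step the slope is \<open>\<rho> S\<close>, where \<open>S\<close> is the squared length of the step in the norm of the
optimal Hessian. The decrease of \<open>f\<close> is then at least \<open>(\<rho> - (1 + C) / 2) S\<close> and \<open>s \<bullet> y\<close> is at least
\<open>S / (1 + C)\<close>. So up to factors \<open>1 + C\<close> the loss is the logarithm of \<open>\<rho>\<^sup>2 / (2 \<rho> - 1 - C)\<close>, which
vanishes to second order at \<open>\<rho> = 1\<close> if \<open>C = 0\<close>.
\<close>

lemma loss_le_unit_step:
  assumes c: "C k \<le> \<delta>1" and \<rho>: "\<delta>2 \<le> \<rho> k" "\<rho> k \<le> \<delta>3"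
  shows "loss k \<le> \<delta>5 * omega (\<rho> k - 1) + (3 + 1 / (2 * \<delta>2 - 1 - \<delta>1)) * C k + \<Psi> k - \<Psi> (Suc k)"
proof -
  define r c \<gamma> \<sigma> S where "r = \<rho> k" and "c = C k" and "\<gamma> = slope k" and "\<sigma> = step k \<bullet> grad_diff k"
    and "S = step k \<bullet> (H xs *v step k)"
  define \<Delta> where "\<Delta> = 2 * \<delta>2 - 1 - \<delta>1"
  have pos: "0 \<le> c" "0 < S" "0 < \<gamma>" "0 < r" "0 < \<Delta>"
    using C_facts(1) weighted_step_pos step_facts(2) rho_pos delta2_gap
    by (simp_all add: c_def S_def \<gamma>_def r_def \<Delta>_def)
  have \<gamma>: "\<gamma> = r * S"
    using unit_step_if_rho_near_1[OF assms] step_facts(4)[of k] pos by (simp add: r_def \<rho>_def \<gamma>_def S_def)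
  have D: "\<Delta> \<le> 2 * r - 1 - c" using assms by (simp add: r_def c_def \<Delta>_def)
  note bounds = sublevel_step_bounds[OF f_decreases[of k], folded C_def iterate_facts(6), folded grad_diff_def, folded \<sigma>_def S_def c_def]
  have "gap k - gap (Suc k) \<ge> \<gamma> - (1 + c) * S / 2" using bounds(1) by (simp add: gap_def slope_def \<gamma>_def)
  hence "(\<gamma> - (1 + c) * S / 2) / \<gamma> \<le> (gap k - gap (Suc k)) / \<gamma>" using pos by (intro divide_right_mono) auto
  moreover have "(\<gamma> - (1 + c) * S / 2) / \<gamma> = (2 * r - 1 - c) / (2 * r)" using pos by (simp add: \<gamma> field_simps)
  ultimately have p: "(2 * r - 1 - c) / (2 * r) \<le> (gap k - gap (Suc k)) / \<gamma>" by simp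
  have "S / (1 + c) / \<gamma> \<le> \<sigma> / \<gamma>" using bounds(2) pos by (intro divide_right_mono) auto
  moreover have "S / (1 + c) / \<gamma> = 1 / ((1 + c) * r)" using pos by (simp add: \<gamma>)
  ultimately have n: "1 / ((1 + c) * r) \<le> \<sigma> / \<gamma>" by simp
  define q where "q = (2 * r - 1 - c) / (2 * r) * (1 / ((1 + c) * r))"
  have q: "q > 0" using D pos by (simp add: q_def)
  have "q \<le> (gap k - gap (Suc k)) / \<gamma> * (\<sigma> / \<gamma>)" unfolding q_def
    using p n D pos order_trans[OF _ p, of 0] by (intro mult_mono) auto
  from loss_le_weighted[OF q this[unfolded \<gamma>_def \<sigma>_def]]
  have "loss k \<le> - ln (2 * q) + 2 * c + \<Psi> k - \<Psi> (Suc k)" by (simp add: c_def)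
  moreover have "- ln (2 * q) = ln (r\<^sup>2 / (2 * r - 1 - c)) + ln (1 + c)"
  proof -
    define a where "a = 2 * r - 1 - c"
    have "a > 0" using pos D by (simp add: a_def)
    hence "2 * q = 1 / ((r\<^sup>2 / a) * (1 + c))" using pos by (simp add: q_def power2_eq_square flip: a_def)
    hence "2 * q = 1 / ((r\<^sup>2 / (2 * r - 1 - c)) * (1 + c))" by (simp only: a_def)
    moreover have "ln ((r\<^sup>2 / (2 * r - 1 - c)) * (1 + c)) = ln (r\<^sup>2 / (2 * r - 1 - c)) + ln (1 + c)"
      using pos D by (intro ln_mult_pos divide_pos_pos) auto
    moreover have "0 < (r\<^sup>2 / (2 * r - 1 - c)) * (1 + c)" using pos D by (intro mult_pos_pos divide_pos_pos) auto
    moreover have "- ln (1 / Z) = ln Z" if "0 < Z" for Z :: real using that by (simp add: ln_div)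
    ultimately show ?thesis by presburger
  qed
  moreover have "ln (1 + c) \<le> c" using pos by (intro ln_add_one_self_le_self)
  moreover have "ln (r\<^sup>2 / (2 * r - 1 - c)) \<le> \<delta>5 * omega (r - 1) + 1 / \<Delta> * c"
  proof -
    have "ln (r\<^sup>2 / (2 * r - 1 - c)) \<le> r\<^sup>2 / (2 * r - 1 - c) - 1"
      using pos D by (intro ln_le_minus_one divide_pos_pos) auto
    also have "\<dots> = ((r - 1)\<^sup>2 + c) / (2 * r - 1 - c)" using pos D by (simp add: field_simps power2_eq_square)
    also have "\<dots> \<le> ((r - 1)\<^sup>2 + c) / \<Delta>" using pos D by (intro divide_left_mono) auto
    also have "\<dots> \<le> \<delta>5 * omega (r - 1) + 1 / \<Delta> * c"
      using square_le_omega_inside_interval[OF \<rho>] by (simp add: r_def \<Delta>_def add_divide_distrib)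
    finally show ?thesis .
  qed
  ultimately have "loss k \<le> \<delta>5 * omega (r - 1) + 1 / \<Delta> * c + 3 * c + \<Psi> k - \<Psi> (Suc k)" by linarith
  thus ?thesis by (simp add: r_def c_def \<Delta>_def algebra_simps)
qed

text \<open>
Three cases: if \<open>C\<close> exceeds \<open>\<delta>\<^sub>1\<close>, the generic loss \<open>\<delta>\<^sub>6\<close> is paid directly. If \<open>\<rho>\<close> lies outside
\<open>[\<delta>\<^sub>2, \<delta>\<^sub>3]\<close>, then \<open>\<delta>\<^sub>6\<close> is at most \<open>\<delta>\<^sub>4 \<delta>\<^sub>6 \<omega>(\<rho> - 1)\<close>. Otherwise the step is a unit step, whose loss is
covered by \<open>\<delta>\<^sub>5 \<omega>(\<rho> - 1)\<close>. The potential absorbs \<open>\<omega>(\<rho> - 1)\<close> in turn, and \<open>\<delta>\<^sub>7 - 1\<close> is the sum of the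
coefficients \<open>\<delta>\<^sub>4 \<delta>\<^sub>6\<close> and \<open>\<delta>\<^sub>5\<close>.
\<close>

lemma loss_le_superlinear:
  "loss k \<le> (if \<delta>1 < C k then \<delta>6 else 0) + \<delta>7 * (\<Psi> k - \<Psi> (Suc k)) + \<delta>8 * C k"
proof -
  define e \<Delta> where "e = (if \<delta>1 < C k then \<delta>6 else 0)" and "\<Delta> = 2 * \<delta>2 - 1 - \<delta>1"
  define w where "w = omega (\<rho> k - 1)"
  have C: "C k \<ge> 0" by (rule C_facts(1))
  have w: "w \<ge> 0" using rho_pos[of k] by (simp add: w_def omega_nonneg)
  have D: "0 \<le> 1 / \<Delta> * C k" using C delta2_gap by (simp add: \<Delta>_def)
  have d4: "0 \<le> \<delta>4 * \<delta>6 * w" and d5: "0 \<le> \<delta>5 * w" using w delta4_pos delta5_pos delta6_pos by simp_all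
  have "loss k \<le> e + (\<delta>4 * \<delta>6 * w + \<delta>5 * w) + (3 * C k + 1 / \<Delta> * C k) + (\<Psi> k - \<Psi> (Suc k))"
  proof (cases "\<delta>1 < C k")
    case True
    thus ?thesis using loss_le_generic[of k] D C d4 d5 by (simp add: e_def)
  next
    case False
    show ?thesis
    proof (cases "\<delta>2 \<le> \<rho> k \<and> \<rho> k \<le> \<delta>3")
      case True
      hence "loss k \<le> \<delta>5 * w + (3 + 1 / \<Delta>) * C k + \<Psi> k - \<Psi> (Suc k)"
        using loss_le_unit_step[of k] False by (simp add: w_def \<Delta>_def)
      thus ?thesis using False d4 by (simp add: e_def algebra_simps)
    next
      case outside: False
      have "\<delta>6 * 1 \<le> \<delta>6 * (\<delta>4 * w)"
        using omega_outside_interval[OF rho_pos outside] delta6_pos by (simp add: w_def)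
      hence "\<delta>6 \<le> \<delta>4 * \<delta>6 * w" by (simp add: mult_ac)
      thus ?thesis using loss_le_generic[of k] False D C d5 by (simp add: e_def)
    qed
  qed
  also have "\<delta>4 * \<delta>6 * w + \<delta>5 * w = (\<delta>7 - 1) * w" by (simp add: delta7_def algebra_simps)
  also have "(\<delta>7 - 1) * w \<le> (\<delta>7 - 1) * (\<Psi> k - \<Psi> (Suc k) + 2 * C k)"
    using delta7_ge_1 omega_rho_le[of k] by (intro mult_left_mono) (auto simp: w_def)
  finally have "loss k \<le> e + \<delta>7 * (\<Psi> k - \<Psi> (Suc k)) + (1 + 2 * \<delta>7 + 1 / \<Delta>) * C k"
    by (simp add: algebra_simps)
  moreover have "(1 + 2 * \<delta>7 + 1 / \<Delta>) * C k \<le> \<delta>8 * C k"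
    using delta8_ge C by (intro mult_right_mono) (auto simp: \<Delta>_def)
  ultimately show ?thesis by (simp add: e_def)
qed

lemma sum_loss_superlinear:
  "(\<Sum>k<t. loss k) \<le> \<delta>6 * real (card {k. k < t \<and> \<delta>1 < C k}) + \<delta>7 * \<Psi> 0 + \<delta>8 * (\<Sum>k<t. C k)"
proof -
  have "(\<Sum>k<t. loss k) \<le> (\<Sum>k<t. (if \<delta>1 < C k then \<delta>6 else 0) + \<delta>7 * (\<Psi> k - \<Psi> (Suc k)) + \<delta>8 * C k)"
    by (intro sum_mono loss_le_superlinear)
  also have "\<dots> = (\<Sum>k<t. if \<delta>1 < C k then \<delta>6 else 0) + \<delta>7 * (\<Psi> 0 - \<Psi> t) + \<delta>8 * (\<Sum>k<t. C k)"
    by (simp only: sum.distrib sum_distrib_left[symmetric] sum_lessThan_telescope'[of "\<lambda>k. \<Psi> k"])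
  also have "(\<Sum>k<t. if \<delta>1 < C k then \<delta>6 else 0) = \<delta>6 * real (card {k. k < t \<and> \<delta>1 < C k})"
  proof -
    have "{k \<in> {..<t}. \<delta>1 < C k} = {k. k < t \<and> \<delta>1 < C k}" by auto
    thus ?thesis by (simp add: sum.inter_filter[symmetric])
  qed
  also have "\<delta>7 * (\<Psi> 0 - \<Psi> t) \<le> \<delta>7 * \<Psi> 0"
    using delta7_ge_1 potential_nonneg[OF hessian_spd[of xs] B_spd[of t]] by simp
  finally show ?thesis by simp
qed

section \<open>Linear and superlinear rates from the sum of losses\<close>

text \<open>
With the weight \<open>L I\<close> the Lipschitz bound on the gradient makes the correction
\<open>(y \<bullet> P\<^sup>-\<^sup>1 y) / (s \<bullet> y) - 1\<close> nonpositive, and strong convexity gives gradient domination with the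
constant \<open>\<mu> / L\<close>.
\<close>

lemma sum_loss_linear:
  "(\<Sum>k<t. loss k) \<le> real t * (- ln (2 * \<alpha> * (1 - \<beta>) * \<mu> / L)) + bfgs_potential (L *\<^sub>R mat 1) (B 0)"
proof -
  let ?P = "L *\<^sub>R mat 1 :: real^'n^'n"
  define V where "V k = bfgs_potential ?P (B k)" for k
  have P: "sym_pos_def ?P" by (rule spd_scaleR[OF spd_mat_1 L_pos])
  have "loss k \<le> - ln (2 * \<alpha> * (1 - \<beta>) * \<mu> / L) + (V k - V (Suc k))" for k
  proof -
    have dom: "2 * (\<mu> / L) * gap k \<le> g (x k) \<bullet> (matrix_inv ?P *v g (x k))"
      unfolding gap_def
      by (rule weighted_gradient_domination[OF P])
         (use mu_pos L_pos hessian_lower in \<open>auto simp: scaleR_mat_1_vec\<close>)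
    have "grad_diff k \<bullet> (matrix_inv ?P *v grad_diff k) \<le> 1 * (step k \<bullet> grad_diff k)"
      unfolding grad_diff_def iterate_facts(6)
      by (rule weighted_cocoercivity[OF P]) (use hessian_upper in \<open>auto simp: scaleR_mat_1_vec\<close>)
    hence N: "(grad_diff k \<bullet> (matrix_inv ?P *v grad_diff k)) / (step k \<bullet> grad_diff k) \<le> 1"
      using curvature_pos[of k] by simp
    have "loss k \<le> - ln (2 * (\<mu> / L) * (\<alpha> * (1 - \<beta>))) + V k - V (Suc k)
        + (grad_diff k \<bullet> (matrix_inv ?P *v grad_diff k)) / (step k \<bullet> grad_diff k) - 1"
      unfolding V_def using mu_pos L_pos alpha_pos beta_less
      by (intro loss_le_potential[OF P _ dom _ armijo_wolfe_product]) auto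
    thus ?thesis using N by (simp add: mult_ac)
  qed
  hence "(\<Sum>k<t. loss k) \<le> (\<Sum>k<t. - ln (2 * \<alpha> * (1 - \<beta>) * \<mu> / L) + (V k - V (Suc k)))" by (intro sum_mono)
  also have "\<dots> = real t * (- ln (2 * \<alpha> * (1 - \<beta>) * \<mu> / L)) + (V 0 - V t)"
    by (simp only: sum.distrib sum_lessThan_telescope') simp
  finally show ?thesis using potential_nonneg[OF P B_spd[of t]] by (simp add: V_def)
qed

text \<open>
If \<open>r\<^sub>k\<close> is the fraction of the gap removed in iteration \<open>k\<close>, the gap ratio is the product of
\<open>1 - r\<^sub>k \<le> exp (- r\<^sub>k)\<close>. The sum of the \<open>r\<^sub>k\<close> is at least \<open>t\<close> times their geometric mean, which the sum of
losses bounds below.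
\<close>

lemma gap_ratio_linear:
  assumes t: "t \<ge> 1" and D: "bfgs_potential (L *\<^sub>R mat 1) (B 0) \<le> D"
  shows "gap t / gap 0 \<le> exp (- 2 * \<alpha> * (1 - \<beta>) * \<mu> / L * real t * exp (- D / real t))"
proof -
  define q where "q = 2 * \<alpha> * (1 - \<beta>) * \<mu> / L"
  have q: "q > 0" using alpha_pos beta_less mu_pos L_pos by (simp add: q_def)
  have "(\<Sum>k<t. loss k) / real t \<le> - ln q + D / real t"
    using sum_loss_linear[of t] D t by (simp add: q_def field_simps)
  hence "exp (ln q + - D / real t) \<le> exp (- ((\<Sum>k<t. loss k) / real t))" by simp
  hence "real t * (q * exp (- D / real t)) \<le> real t * exp (- ((\<Sum>k<t. loss k) / real t))"
    unfolding exp_add using q by (intro mult_left_mono) auto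
  also have "\<dots> \<le> (\<Sum>k<t. exp (- loss k))" by (rule sum_exp_ge_exp_mean[OF t])
  also have "\<dots> = (\<Sum>k<t. 1 - gap (Suc k) / gap k)" by (simp only: loss_def minus_minus exp_ln rate_pos)
  finally have *: "real t * (q * exp (- D / real t)) \<le> (\<Sum>k<t. 1 - gap (Suc k) / gap k)" .
  have "gap t / gap 0 \<le> (\<Prod>k<t. exp (- (1 - gap (Suc k) / gap k)))"
    unfolding gap_ratio_prod
  proof (rule prod_mono)
    fix k
    show "0 \<le> gap (Suc k) / gap k \<and> gap (Suc k) / gap k \<le> exp (- (1 - gap (Suc k) / gap k))"
      using gap_pos[of k] gap_pos[of "Suc k"] exp_ge_add_one_self[of "- (1 - gap (Suc k) / gap k)"] by auto
  qed
  also have "\<dots> = exp (- (\<Sum>k<t. 1 - gap (Suc k) / gap k))" by (simp only: exp_sum[symmetric] finite_lessThan sum_negf)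
  also have "\<dots> \<le> exp (- (real t * (q * exp (- D / real t))))" using * by simp
  finally show ?thesis by (simp add: q_def mult_ac)
qed

lemma gap_ratio_superlinear:
  assumes t: "t \<ge> 1" and bound: "(\<Sum>k<t. loss k) \<le> R"
  shows "gap t / gap 0 \<le> (R / real t) ^ t"
proof -
  have r: "0 < gap (Suc k) / gap k" for k using gap_pos by simp
  have le: "(\<Sum>k<t. gap (Suc k) / gap k) \<le> R" using bound by (meson order_trans ratio_le_loss sum_mono)
  have "gap t / gap 0 \<le> ((\<Sum>k<t. gap (Suc k) / gap k) / real t) ^ t"
    unfolding gap_ratio_prod by (rule prod_le_power_of_mean[OF r t])
  also have "\<dots> \<le> (R / real t) ^ t"
    using le r by (intro power_mono divide_right_mono divide_nonneg_nonneg sum_nonneg less_imp_le[OF r]) auto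
  finally show ?thesis .
qed

section \<open>The length of the initial phase and the final rates\<close>

text \<open>
After the first \<open>D\<close> iterations, \<open>C\<close> decays at least with the rate \<open>decay / exp 1\<close>.
\<close>

definition "decay = \<alpha> * (1 - \<beta>) * \<mu> / L"

lemma decay_bounds: "0 < decay" "decay \<le> 1/4"
proof -
  show "0 < decay" using alpha_pos beta_less mu_pos L_pos by (simp add: decay_def)
  have "0 \<le> (\<beta> - 1/2)\<^sup>2" by simp
  hence "\<beta> * (1 - \<beta>) \<le> 1/4" by (simp add: power2_eq_square algebra_simps)
  moreover have "\<alpha> * (1 - \<beta>) \<le> \<beta> * (1 - \<beta>)" using alpha_beta beta_less by (intro mult_right_mono) auto
  ultimately have quarter: "\<alpha> * (1 - \<beta>) \<le> 1/4" by linarith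
  have "\<alpha> * (1 - \<beta>) * (\<mu> / L) \<le> 1/4 * 1"
    by (rule mult_mono[OF quarter]) (use alpha_pos beta_less mu_pos mu_le_L L_pos in auto)
  thus "decay \<le> 1/4" by (simp add: decay_def)
qed

text \<open>
From iteration \<open>D\<close> on, the factor \<open>exp (- D / k)\<close> in the linear rate is at least \<open>exp (- 1)\<close>. The
factor 2 in that rate disappears because \<open>C\<close> is proportional to the square root of the gap.
\<close>

lemma C_linear_decay:
  assumes D: "bfgs_potential (L *\<^sub>R mat 1) (B 0) \<le> D" and k: "D \<le> real k"
  shows "C k \<le> C 0 * exp (- (decay / exp 1) * real k)"
proof (cases "k = 0")
  case False
  have "- 1 \<le> - D / real k" using k False by (simp add: field_simps)
  hence "exp (- 1) \<le> exp (- D / real k)" by simp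
  hence "2 * decay * real k * exp (- 1) \<le> 2 * decay * real k * exp (- D / real k)"
    using decay_bounds by (intro mult_left_mono) auto
  hence "exp (- (2 * decay * real k * exp (- D / real k))) \<le> exp (- (2 * decay * real k * exp (- 1)))" by simp
  moreover have "gap k / gap 0 \<le> exp (- (2 * decay * real k * exp (- D / real k)))"
    using gap_ratio_linear[OF _ D, of k] False by (simp add: decay_def mult.assoc)
  ultimately have "gap k / gap 0 \<le> exp (- (2 * decay * real k * exp (- 1)))" by linarith
  hence "sqrt (gap k / gap 0) \<le> sqrt (exp (- (2 * decay * real k * exp (- 1))))" by (rule real_sqrt_le_mono)
  also have "exp (- (2 * decay * real k * exp (- 1))) = (exp (- (decay / exp 1) * real k))\<^sup>2"
    by (simp add: power2_eq_square exp_add[symmetric] exp_minus field_simps)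
  finally have "sqrt (gap k / gap 0) \<le> exp (- (decay / exp 1) * real k)" by simp
  thus ?thesis unfolding C_facts(3)[of k] using C_facts(1)[of 0] by (intro mult_left_mono)
qed simp

lemma sum_C_le:
  assumes D: "bfgs_potential (L *\<^sub>R mat 1) (B 0) \<le> D" "0 \<le> D"
  shows "(\<Sum>k<t. C k) \<le> C 0 * (D + 1 + exp 1 / decay)"
proof -
  let ?a = "decay / exp 1"
  have "(\<Sum>k<t. C k) \<le> (\<Sum>k<t. C 0 * (if real k < D then 1 else exp (- ?a * real k)))"
    by (intro sum_mono) (use C_facts(2) C_linear_decay[OF D(1)] in \<open>auto simp: not_less\<close>)
  also have "\<dots> = C 0 * (\<Sum>k<t. if real k < D then 1 else exp (- ?a * real k))" by (rule sum_distrib_left[symmetric])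
  also have "\<dots> \<le> C 0 * (D + 1 + 1 / ?a)"
    using decay_bounds C_facts(1)[of 0] by (intro mult_left_mono sum_delayed_geometric[OF D(2)]) auto
  finally show ?thesis by simp
qed

lemma card_initial_phase:
  assumes D: "bfgs_potential (L *\<^sub>R mat 1) (B 0) \<le> D" "0 \<le> D" and C0: "\<delta>1 < C 0"
  shows "real (card {k. k < t \<and> \<delta>1 < C k}) \<le> D + log_plus (C 0 / \<delta>1) * (3 / decay) + 1"
proof (rule card_nat_less_real)
  have lp: "0 \<le> log_plus (C 0 / \<delta>1)" by (simp add: log_plus_def)
  hence nn: "0 \<le> log_plus (C 0 / \<delta>1) * (3 / decay)" using decay_bounds by simp
  thus "0 \<le> D + log_plus (C 0 / \<delta>1) * (3 / decay)" using D(2) by simp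
  fix k assume "k \<in> {k. k < t \<and> \<delta>1 < C k}"
  hence k: "\<delta>1 < C k" by simp
  show "real k < D + log_plus (C 0 / \<delta>1) * (3 / decay)"
  proof (cases "real k < D")
    case True
    thus ?thesis using nn by simp
  next
    case False
    have "\<delta>1 < C 0 * exp (- (decay / exp 1) * real k)" using C_linear_decay[OF D(1), of k] False k by simp
    hence "1 < C 0 / \<delta>1 * exp (- (decay / exp 1) * real k)" using delta1(1) by (simp add: field_simps)
    hence "0 < ln (C 0 / \<delta>1 * exp (- (decay / exp 1) * real k))" by simp
    also have "\<dots> = ln (C 0 / \<delta>1) - decay / exp 1 * real k"
      using delta1(1) C0 by (subst ln_mult_pos) auto
    also have "\<dots> \<le> log_plus (C 0 / \<delta>1) - decay / exp 1 * real k" by (simp add: log_plus_def)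
    finally have "real k < log_plus (C 0 / \<delta>1) * (exp 1 / decay)" using decay_bounds by (simp add: field_simps)
    also have "\<dots> \<le> log_plus (C 0 / \<delta>1) * (3 / decay)"
      using lp decay_bounds exp_1_bound by (intro mult_left_mono divide_right_mono) auto
    finally show ?thesis using D(2) by simp
  qed
qed

text \<open>
The sum of all \<open>C\<^sub>k\<close> is at most \<open>C\<^sub>0 (D + 1 + exp 1 / decay)\<close>. Since \<open>decay \<le> 1 / 4\<close>, replacing this by
\<open>C\<^sub>0 (D + 3 / decay)\<close> leaves a surplus of \<open>C\<^sub>0 / 8\<close>. If \<open>C\<^sub>0 > \<delta>\<^sub>1\<close>, this surplus pays for the rounding
up in the number of iterations with \<open>C\<^sub>k > \<delta>\<^sub>1\<close>; if \<open>C\<^sub>0 \<le> \<delta>\<^sub>1\<close>, there are no such iterations.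
\<close>

lemma sum_loss_total:
  assumes D: "bfgs_potential (L *\<^sub>R mat 1) (B 0) \<le> D" "0 \<le> D"
  shows "(\<Sum>k<t. loss k) \<le> \<delta>6 * (D + log_plus (C 0 / \<delta>1) * (3 / decay)) + \<delta>7 * \<Psi> 0 + \<delta>8 * (C 0 * (D + 3 / decay))"
proof -
  define lp n where "lp = log_plus (C 0 / \<delta>1) * (3 / decay)" and "n = real (card {k. k < t \<and> \<delta>1 < C k})"
  have lp: "0 \<le> lp" using decay_bounds by (simp add: lp_def log_plus_def)
  have slack: "1/8 \<le> 3 / decay - 1 - exp 1 / decay"
  proof -
    have "3 - exp 1 \<ge> (0::real)" using exp_1_bound by simp
    hence "(3 - exp 1) * 4 \<le> (3 - exp 1) * (1 / decay)"
      using decay_bounds by (intro mult_left_mono) (auto simp: field_simps)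
    hence "(3 - exp 1) * 4 \<le> 3 / decay - exp 1 / decay" by (simp add: diff_divide_distrib)
    moreover have "1 / 8 + 1 \<le> (3 - exp 1) * (4::real)" using exp_1_bound by simp
    ultimately have "1 / 8 + 1 \<le> 3 / decay - exp 1 / decay" by (rule order_trans[rotated])
    thus ?thesis by simp
  qed
  have "\<delta>6 * n + \<delta>8 * (C 0 * (D + 1 + exp 1 / decay)) \<le> \<delta>6 * (D + lp) + \<delta>8 * (C 0 * (D + 3 / decay))"
  proof (cases "\<delta>1 < C 0")
    case True
    have "\<delta>6 * n \<le> \<delta>6 * (D + lp + 1)"
      using card_initial_phase[OF D True] delta6_pos by (intro mult_left_mono) (auto simp: n_def lp_def)
    hence "\<delta>6 * n \<le> \<delta>6 * (D + lp) + \<delta>6" by (simp add: algebra_simps)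
    moreover have "\<delta>6 \<le> \<delta>8 * (C 0 * (1/8))" using delta8_absorbs_delta6[OF True] by simp
    moreover have "\<delta>8 * (C 0 * (1/8)) \<le> \<delta>8 * (C 0 * (3 / decay - 1 - exp 1 / decay))"
      using slack delta8_pos C_facts(1)[of 0] by (intro mult_left_mono) auto
    moreover have "\<dots> = \<delta>8 * (C 0 * (D + 3 / decay)) - \<delta>8 * (C 0 * (D + 1 + exp 1 / decay))"
      by (simp add: algebra_simps)
    ultimately show ?thesis by linarith
  next
    case False
    have "{k. k < t \<and> \<delta>1 < C k} = {}" using C_facts(2) False by (auto simp: not_less intro: order_trans)
    hence "n = 0" by (simp add: n_def)
    moreover have "\<delta>8 * (C 0 * (D + 1 + exp 1 / decay)) \<le> \<delta>8 * (C 0 * (D + 3 / decay))"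
      using slack delta8_pos C_facts(1)[of 0] by (intro mult_left_mono) auto
    moreover have "0 \<le> \<delta>6 * (D + lp)" using delta6_pos lp D by simp
    ultimately show ?thesis by simp
  qed
  moreover have "\<delta>8 * (\<Sum>k<t. C k) \<le> \<delta>8 * (C 0 * (D + 1 + exp 1 / decay))"
    using sum_C_le[OF D] delta8_pos by (intro mult_left_mono) auto
  ultimately show ?thesis using sum_loss_superlinear[of t] by (simp add: n_def lp_def)
qed

lemma initial_potentials:
  assumes "B 0 = c *\<^sub>R mat 1" "c > 0"
  shows "bfgs_potential (L *\<^sub>R mat 1) (B 0) \<le> real CARD('n) * (c / L - 1 + ln (L / c))"
    and "\<Psi> 0 \<le> real CARD('n) * (c / \<mu> - 1 + ln (L / c))"
  unfolding assms(1)
  by (rule potential_scaled_identity_le;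
      use assms(2) L_pos mu_pos hessian_lower hessian_upper hessian_spd spd_scaleR[OF spd_mat_1 L_pos] in
        \<open>simp add: scaleR_mat_1_vec\<close>)+

lemma rate_from_L_identity:
  assumes B0: "B 0 = L *\<^sub>R mat 1" and t: "t \<ge> 1"
  shows "gap t / gap 0 \<le> ((\<delta>7 * real CARD('n) * (L / \<mu>)
    + (3 * \<delta>6 / (\<alpha> * (1 - \<beta>)) * log_plus (C 0 / \<delta>1) + 3 * \<delta>8 / (\<alpha> * (1 - \<beta>)) * C 0) * (L / \<mu>)) / real t) ^ t"
proof (rule gap_ratio_superlinear[OF t])
  have "\<Psi> 0 \<le> real CARD('n) * (L / \<mu>)"
    using initial_potentials(2)[OF B0 L_pos] L_pos by (simp add: algebra_simps)
  hence \<Psi>: "\<delta>7 * \<Psi> 0 \<le> \<delta>7 * (real CARD('n) * (L / \<mu>))" using delta7_ge_1 by (intro mult_left_mono) auto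
  have "bfgs_potential (L *\<^sub>R mat 1) (B 0) \<le> 0"
    using initial_potentials(1)[OF B0 L_pos] L_pos by simp
  hence "(\<Sum>k<t. loss k) \<le> \<delta>6 * (log_plus (C 0 / \<delta>1) * (3 / decay)) + \<delta>7 * \<Psi> 0 + \<delta>8 * (C 0 * (3 / decay))"
    using sum_loss_total[of 0 t] by simp
  also have "\<dots> \<le> \<delta>6 * (log_plus (C 0 / \<delta>1) * (3 / decay)) + \<delta>7 * (real CARD('n) * (L / \<mu>)) + \<delta>8 * (C 0 * (3 / decay))"
    using \<Psi> by simp
  also have "3 / decay = 3 / (\<alpha> * (1 - \<beta>)) * (L / \<mu>)" by (simp add: decay_def)
  finally show "(\<Sum>k<t. loss k) \<le> \<delta>7 * real CARD('n) * (L / \<mu>)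
    + (3 * \<delta>6 / (\<alpha> * (1 - \<beta>)) * log_plus (C 0 / \<delta>1) + 3 * \<delta>8 / (\<alpha> * (1 - \<beta>)) * C 0) * (L / \<mu>)"
    by (simp add: algebra_simps)
qed

lemma rate_from_mu_identity:
  assumes B0: "B 0 = \<mu> *\<^sub>R mat 1" and t: "t \<ge> 1"
  shows "gap t / gap 0 \<le> (((\<delta>6 + \<delta>7 + \<delta>8 * C 0) * real CARD('n) * ln (L / \<mu>)
    + (3 * \<delta>6 / (\<alpha> * (1 - \<beta>)) * log_plus (C 0 / \<delta>1) + 3 * \<delta>8 / (\<alpha> * (1 - \<beta>)) * C 0) * (L / \<mu>)) / real t) ^ t"
proof (rule gap_ratio_superlinear[OF t])
  define D where "D = real CARD('n) * ln (L / \<mu>)"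
  have D0: "0 \<le> D" using mu_le_L mu_pos by (simp add: D_def)
  have "\<Psi> 0 \<le> D" using initial_potentials(2)[OF B0 mu_pos] mu_pos by (simp add: D_def)
  hence \<Psi>: "\<delta>7 * \<Psi> 0 \<le> \<delta>7 * D" using delta7_ge_1 by (intro mult_left_mono) auto
  have "real CARD('n) * (\<mu> / L - 1 + ln (L / \<mu>)) \<le> D"
    unfolding D_def using mu_le_L L_pos by (intro mult_left_mono) auto
  hence "bfgs_potential (L *\<^sub>R mat 1) (B 0) \<le> D"
    using initial_potentials(1)[OF B0 mu_pos] by linarith
  hence "(\<Sum>k<t. loss k) \<le> \<delta>6 * (D + log_plus (C 0 / \<delta>1) * (3 / decay)) + \<delta>7 * \<Psi> 0 + \<delta>8 * (C 0 * (D + 3 / decay))"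
    using sum_loss_total D0 by blast
  also have "\<dots> \<le> \<delta>6 * (D + log_plus (C 0 / \<delta>1) * (3 / decay)) + \<delta>7 * D + \<delta>8 * (C 0 * (D + 3 / decay))"
    using \<Psi> by simp
  also have "3 / decay = 3 / (\<alpha> * (1 - \<beta>)) * (L / \<mu>)" by (simp add: decay_def)
  finally show "(\<Sum>k<t. loss k) \<le> (\<delta>6 + \<delta>7 + \<delta>8 * C 0) * real CARD('n) * ln (L / \<mu>)
    + (3 * \<delta>6 / (\<alpha> * (1 - \<beta>)) * log_plus (C 0 / \<delta>1) + 3 * \<delta>8 / (\<alpha> * (1 - \<beta>)) * C 0) * (L / \<mu>)"
    by (simp add: D_def algebra_simps)
qed

end

theorem corollary6p5:
  fixes f :: "real^'n \<Rightarrow> real"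
    and \<mu> L M \<kappa> \<alpha> \<beta> C0 :: real
    and xs :: "real^'n"
    and x :: "nat \<Rightarrow> real^'n"
    and B :: "nat \<Rightarrow> real^'n^'n"
    and \<eta> :: "nat \<Rightarrow> real"
    and t :: nat
  assumes "twice_differentiable f"
    and "\<mu> > 0" and "strongly_convex \<mu> f"
    and "L > 0" and "L-lipschitz_on UNIV (gradient f)"
    and "M > 0" and "hessian_lipschitz M f"
    and "\<kappa> = L / \<mu>"
    and "\<forall>y. f xs \<le> f y"
    and "0 < \<alpha>" and "\<alpha> < \<beta>" and "\<beta> < 1" and "\<alpha> < 1/2"
    and "bfgs_iterates f x B \<eta>"
    and "\<forall>k. armijo_wolfe f \<alpha> \<beta> (x k) (bfgs_direction f (x k) (B k)) (\<eta> k)"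
    and "\<forall>k. armijo_wolfe f \<alpha> \<beta> (x k) (bfgs_direction f (x k) (B k)) 1 \<longrightarrow> \<eta> k = 1"
    and "C0 = C_const M \<mu> f xs (x 0)"
    and "t \<ge> 1"
  shows "(B 0 = L *\<^sub>R mat 1 \<longrightarrow>
            (f (x t) - f xs) / (f (x 0) - f xs)
              \<le> ((delta7 \<alpha> \<beta> * real CARD('n) * \<kappa>
                    + (3 * delta6 \<alpha> \<beta> / (\<alpha> * (1 - \<beta>)) * log_plus (C0 / delta1 \<alpha> \<beta>)
                       + 3 * delta8 \<alpha> \<beta> / (\<alpha> * (1 - \<beta>)) * C0) * \<kappa>) / real t) ^ t)
       \<and> (B 0 = \<mu> *\<^sub>R mat 1 \<longrightarrow>
            (f (x t) - f xs) / (f (x 0) - f xs)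
              \<le> (((delta6 \<alpha> \<beta> + delta7 \<alpha> \<beta> + delta8 \<alpha> \<beta> * C0) * real CARD('n) * ln \<kappa>
                    + (3 * delta6 \<alpha> \<beta> / (\<alpha> * (1 - \<beta>)) * log_plus (C0 / delta1 \<alpha> \<beta>)
                       + 3 * delta8 \<alpha> \<beta> / (\<alpha> * (1 - \<beta>)) * C0) * \<kappa>) / real t) ^ t)"
proof -
  interpret bfgs_armijo_wolfe f \<mu> L M xs \<alpha> \<beta> x B \<eta>
    using assms by unfold_locales auto
  have "gap k = f (x k) - f xs" for k by (simp add: gap_def)
  moreover have "C 0 = C0" using assms by (simp add: C_def)
  ultimately show ?thesis
    using rate_from_L_identity rate_from_mu_identity assms(8,18) by simp
qed

end
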